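(* Let $R$ be a ring, $M$ a nonzero uniformly finite $R$-module and $N$ a submodule of $M$ with $N\neq M$. Every shortest uniform decomposition $N=N_1\cap\cdots\cap N_s$ of $N$ in $M$ is an irredundant primary decomposition of $N$ in $M$.
   Context: Rings have $1$ and need not be commutative; module means left module. A submodule $N$ of $M$ is essential if $N\cap L\neq 0$ for every nonzero submodule $L$ of $M$. A module $U$ is uniform if $U\neq 0$ and every nonzero submodule of $U$ is essential in $U$. A module has finite uniform dimension if it contains no infinite direct sum of nonzero submodules; then $\operatorname{u.dim}(M)$ is the number of summands in any essential direct sum of uniform submodules of $M$ ($0$ if $M=0$). Modules $M_1,M_2$ are essentially equivalent if there are essential submodules $L_1\subseteq M_1$, $L_2\subseteq M_2$ with $L_1\simeq L_2$; $[M]$ denotes the equivalence class of $M$. For a module $M$ of finite uniform dimension, $\operatorname{As}_R(M)=\{[U] : U \text{ is a uniform submodule of } M\}$. An $R$-module $M$ is uniformly finite if every factor module of $M$ has finite uniform dimension. A submodule $N$ of $M$ is primary if $\operatorname{u.dim}(M/N)<\infty$ and $\operatorname{As}_R(M/N)$ consists of a single element. A primary decomposition of $N$ in $M$ is an expression $N=N_1\cap\cdots\cap N_s$ ($s\ge 1$ finite) with each $N_i$ a primary submodule of $M$; it is irredundant if no $N_i$ can be dropped without changing the intersection. A uniform decomposition of $N$ in $M$ is an expression $N=N_1\cap\cdots\cap N_s$ ($s\geq 1$ finite) with submodules $N_i$ of $M$ such that each $M/N_i$ is a uniform module; it is shortest if $s=\operatorname{u.dim}(M/N)$. *)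

theory Defs
  imports "HOL-Algebra.Module" "HOL-Algebra.AbelCoset"
begin

text \<open>
  The locale \<^locale>\<open>module\<close> of the library requires a commutative ring of scalars. The record
  type and the locale \<^locale>\<open>submodule\<close> do not, and are reused here.
\<close>

locale left_module = R?: ring R + M?: abelian_group M
  for R :: "('r, 'q) ring_scheme" (structure)
    and M :: "('r, 'm, 'x) module_scheme" (structure) +
  assumes smult_closed [simp, intro]:
      "\<lbrakk>a \<in> carrier R; x \<in> carrier M\<rbrakk> \<Longrightarrow> a \<odot>\<^bsub>M\<^esub> x \<in> carrier M"
    and smult_l_distr:
      "\<lbrakk>a \<in> carrier R; b \<in> carrier R; x \<in> carrier M\<rbrakk> \<Longrightarrow>
        (a \<oplus> b) \<odot>\<^bsub>M\<^esub> x = a \<odot>\<^bsub>M\<^esub> x \<oplus>\<^bsub>M\<^esub> b \<odot>\<^bsub>M\<^esub> x"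
    and smult_r_distr:
      "\<lbrakk>a \<in> carrier R; x \<in> carrier M; y \<in> carrier M\<rbrakk> \<Longrightarrow>
        a \<odot>\<^bsub>M\<^esub> (x \<oplus>\<^bsub>M\<^esub> y) = a \<odot>\<^bsub>M\<^esub> x \<oplus>\<^bsub>M\<^esub> a \<odot>\<^bsub>M\<^esub> y"
    and smult_assoc1:
      "\<lbrakk>a \<in> carrier R; b \<in> carrier R; x \<in> carrier M\<rbrakk> \<Longrightarrow>
        (a \<otimes> b) \<odot>\<^bsub>M\<^esub> x = a \<odot>\<^bsub>M\<^esub> (b \<odot>\<^bsub>M\<^esub> x)"
    and smult_one [simp]:
      "x \<in> carrier M \<Longrightarrow> \<one> \<odot>\<^bsub>M\<^esub> x = x"

abbreviation restrict_to ::
    "('r, 'm, 'x) module_scheme \<Rightarrow> 'm set \<Rightarrow> ('r, 'm, 'x) module_scheme"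
  where "restrict_to M L \<equiv> M\<lparr>carrier := L\<rparr>"

text \<open>
  The fields \<^const>\<open>mult\<close> and \<^const>\<open>one\<close> of a module record carry no meaning.
\<close>

definition factor_module ::
    "('r, 'm, 'x) module_scheme \<Rightarrow> 'm set \<Rightarrow> ('r, 'm set) module"
  where "factor_module M N =
    \<lparr>carrier = a_rcosets\<^bsub>M\<^esub> N, mult = undefined, one = undefined,
     zero = N, add = set_add M,
     smult = (\<lambda>r C. \<Union>x\<in>C. N +>\<^bsub>M\<^esub> (r \<odot>\<^bsub>M\<^esub> x))\<rparr>"

definition modules_isomorphic ::
    "('r, 'q) ring_scheme \<Rightarrow> ('r, 'm, 'x) module_scheme \<Rightarrow> ('r, 'n, 'y) module_scheme \<Rightarrow> bool"
  where "modules_isomorphic R M1 M2 \<longleftrightarrow>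
    (\<exists>f. bij_betw f (carrier M1) (carrier M2) \<and>
      (\<forall>x\<in>carrier M1. \<forall>y\<in>carrier M1. f (x \<oplus>\<^bsub>M1\<^esub> y) = f x \<oplus>\<^bsub>M2\<^esub> f y) \<and>
      (\<forall>r\<in>carrier R. \<forall>x\<in>carrier M1. f (r \<odot>\<^bsub>M1\<^esub> x) = r \<odot>\<^bsub>M2\<^esub> f x))"

definition essential_submodule ::
    "('r, 'q) ring_scheme \<Rightarrow> ('r, 'm, 'x) module_scheme \<Rightarrow> 'm set \<Rightarrow> bool"
  where "essential_submodule R M N \<longleftrightarrow>
    submodule N R M \<and> (\<forall>L. submodule L R M \<and> L \<noteq> {\<zero>\<^bsub>M\<^esub>} \<longrightarrow> N \<inter> L \<noteq> {\<zero>\<^bsub>M\<^esub>})"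

definition uniform_module ::
    "('r, 'q) ring_scheme \<Rightarrow> ('r, 'm, 'x) module_scheme \<Rightarrow> bool"
  where "uniform_module R U \<longleftrightarrow>
    carrier U \<noteq> {\<zero>\<^bsub>U\<^esub>} \<and>
    (\<forall>L. submodule L R U \<and> L \<noteq> {\<zero>\<^bsub>U\<^esub>} \<longrightarrow> essential_submodule R U L)"

definition uniform_submodule ::
    "('r, 'q) ring_scheme \<Rightarrow> ('r, 'm, 'x) module_scheme \<Rightarrow> 'm set \<Rightarrow> bool"
  where "uniform_submodule R M U \<longleftrightarrow>
    submodule U R M \<and> uniform_module R (restrict_to M U)"

definition submodule_sum ::
    "('r, 'm, 'x) module_scheme \<Rightarrow> 'i set \<Rightarrow> ('i \<Rightarrow> 'm set) \<Rightarrow> 'm set"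
  where "submodule_sum M I L = {finsum M x J | x J. finite J \<and> J \<subseteq> I \<and> x \<in> Pi J L}"

definition direct_family ::
    "('r, 'm, 'x) module_scheme \<Rightarrow> 'i set \<Rightarrow> ('i \<Rightarrow> 'm set) \<Rightarrow> bool"
  where "direct_family M I L \<longleftrightarrow>
    (\<forall>i\<in>I. L i \<inter> submodule_sum M (I - {i}) L = {\<zero>\<^bsub>M\<^esub>})"

text \<open>
  In a direct family of nonzero submodules the members are pairwise distinct, so an infinite
  direct sum of nonzero submodules can be indexed by the set of its summands.
\<close>

definition finite_udim ::
    "('r, 'q) ring_scheme \<Rightarrow> ('r, 'm, 'x) module_scheme \<Rightarrow> bool"
  where "finite_udim R M \<longleftrightarrow>
    \<not> (\<exists>\<S>. infinite \<S> \<and> (\<forall>L\<in>\<S>. submodule L R M \<and> L \<noteq> {\<zero>\<^bsub>M\<^esub>}) \<and>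
          direct_family M \<S> (\<lambda>L. L))"

text \<open>
  Only meaningful for modules of finite uniform dimension. For the zero module the empty
  family (\<open>n = 0\<close>) is the only possible one.
\<close>

definition udim ::
    "('r, 'q) ring_scheme \<Rightarrow> ('r, 'm, 'x) module_scheme \<Rightarrow> nat"
  where "udim R M =
    (THE n. \<exists>U :: nat \<Rightarrow> 'm set.
       (\<forall>i<n. uniform_submodule R M (U i)) \<and> direct_family M {..<n} U \<and>
       essential_submodule R M (submodule_sum M {..<n} U))"

definition ess_equiv ::
    "('r, 'q) ring_scheme \<Rightarrow> ('r, 'm, 'x) module_scheme \<Rightarrow> ('r, 'n, 'y) module_scheme \<Rightarrow> bool"
  where "ess_equiv R M1 M2 \<longleftrightarrow>
    (\<exists>L1 L2. essential_submodule R M1 L1 \<and> essential_submodule R M2 L2 \<and>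
       modules_isomorphic R (restrict_to M1 L1) (restrict_to M2 L2))"

text \<open>
  The class \<open>[M]\<close>, cut down to modules over the same carrier type as \<open>M\<close>. As essential
  equivalence is an equivalence relation, this determines when two classes of modules over
  that type (in particular, of submodules of a fixed module) coincide.
\<close>

definition ess_class ::
    "('r, 'q) ring_scheme \<Rightarrow> ('r, 'm, 'x) module_scheme \<Rightarrow> ('r, 'm, 'x) module_scheme set"
  where "ess_class R M = {V. left_module R V \<and> ess_equiv R M V}"

definition As ::
    "('r, 'q) ring_scheme \<Rightarrow> ('r, 'm, 'x) module_scheme \<Rightarrow> ('r, 'm, 'x) module_scheme set set"
  where "As R M = {ess_class R (restrict_to M U) | U. uniform_submodule R M U}"

definition uniformly_finite ::
    "('r, 'q) ring_scheme \<Rightarrow> ('r, 'm, 'x) module_scheme \<Rightarrow> bool"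
  where "uniformly_finite R M \<longleftrightarrow>
    (\<forall>N. submodule N R M \<longrightarrow> finite_udim R (factor_module M N))"

definition primary_submodule ::
    "('r, 'q) ring_scheme \<Rightarrow> ('r, 'm, 'x) module_scheme \<Rightarrow> 'm set \<Rightarrow> bool"
  where "primary_submodule R M N \<longleftrightarrow>
    submodule N R M \<and> finite_udim R (factor_module M N) \<and>
    is_singleton (As R (factor_module M N))"

definition primary_decomposition ::
    "('r, 'q) ring_scheme \<Rightarrow> ('r, 'm, 'x) module_scheme \<Rightarrow> 'm set \<Rightarrow> nat \<Rightarrow> (nat \<Rightarrow> 'm set) \<Rightarrow> bool"
  where "primary_decomposition R M N s P \<longleftrightarrow>
    s \<ge> 1 \<and> (\<forall>i\<in>{1..s}. primary_submodule R M (P i)) \<and> N = (\<Inter>i\<in>{1..s}. P i)"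

text \<open>
  Intersecting with the carrier makes the empty intersection, which arises for \<open>s = 1\<close>,
  equal to the whole module.
\<close>

definition irredundant ::
    "('r, 'm, 'x) module_scheme \<Rightarrow> 'm set \<Rightarrow> nat \<Rightarrow> (nat \<Rightarrow> 'm set) \<Rightarrow> bool"
  where "irredundant M N s P \<longleftrightarrow>
    (\<forall>j\<in>{1..s}. carrier M \<inter> (\<Inter>i\<in>{1..s} - {j}. P i) \<noteq> N)"

definition uniform_decomposition ::
    "('r, 'q) ring_scheme \<Rightarrow> ('r, 'm, 'x) module_scheme \<Rightarrow> 'm set \<Rightarrow> nat \<Rightarrow> (nat \<Rightarrow> 'm set) \<Rightarrow> bool"
  where "uniform_decomposition R M N s P \<longleftrightarrow>
    s \<ge> 1 \<and>
    (\<forall>i\<in>{1..s}. submodule (P i) R M \<and> uniform_module R (factor_module M (P i))) \<and>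
    N = (\<Inter>i\<in>{1..s}. P i)"

definition shortest_uniform_decomposition ::
    "('r, 'q) ring_scheme \<Rightarrow> ('r, 'm, 'x) module_scheme \<Rightarrow> 'm set \<Rightarrow> nat \<Rightarrow> (nat \<Rightarrow> 'm set) \<Rightarrow> bool"
  where "shortest_uniform_decomposition R M N s P \<longleftrightarrow>
    uniform_decomposition R M N s P \<and> s = udim R (factor_module M N)"

end

theory Submission
  imports Defs
begin

text \<open>
  Two nonzero submodules of a uniform module meet, so all its uniform submodules are essentially
  equivalent; hence submodules with uniform factor module are primary.

  For irredundance, a submodule with uniform factor module is meet irreducible. Let
  \<open>Q\<^sub>1, \<dots>, Q\<^sub>n\<close> be meet irreducible in \<open>V = M/N\<close> with irredundant intersection \<open>0\<close>, and let
  \<open>W\<^sub>i\<close> be the intersection of all \<open>Q\<^sub>j\<close> with \<open>j \<noteq> i\<close>. The \<open>W\<^sub>i\<close> are uniform, their sum is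
  direct, and it contains the intersection of the essential submodules \<open>W\<^sub>i + Q\<^sub>i\<close>. By Steinitz
  exchange the number of summands is an invariant of \<open>V\<close>, so \<open>udim V = n\<close>. If a term of a
  decomposition into \<open>s\<close> terms could be dropped, thinning out the others would give \<open>udim V < s\<close>.
\<close>

text \<open>This amounts to uniformity of the factor module M/Q. Speaking only of submodules of M,
  it can be carried from M to M/N by taking images, without forming a factor module of a factor
  module.\<close>

definition meet_irreducible ::
    "('r, 'q) ring_scheme \<Rightarrow> ('r, 'm, 'x) module_scheme \<Rightarrow> 'm set \<Rightarrow> bool"
  where "meet_irreducible R M Q \<longleftrightarrow>
    submodule Q R M \<and> Q \<noteq> carrier M \<and>
    (\<forall>A B. submodule A R M \<and> submodule B R M \<and> Q \<subset> A \<and> Q \<subset> B \<longrightarrow> A \<inter> B \<noteq> Q)"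

context left_module
begin

section \<open>Arithmetic and submodules in a left module\<close>

lemma smult_zero_right [simp]:
  assumes "a \<in> carrier R" shows "a \<odot>\<^bsub>M\<^esub> \<zero>\<^bsub>M\<^esub> = \<zero>\<^bsub>M\<^esub>"
proof -
  have "a \<odot>\<^bsub>M\<^esub> \<zero>\<^bsub>M\<^esub> \<oplus>\<^bsub>M\<^esub> a \<odot>\<^bsub>M\<^esub> \<zero>\<^bsub>M\<^esub> = a \<odot>\<^bsub>M\<^esub> \<zero>\<^bsub>M\<^esub>"
    using smult_r_distr[of a "\<zero>\<^bsub>M\<^esub>" "\<zero>\<^bsub>M\<^esub>"] assms by simp
  then show ?thesis using assms M.add.l_cancel_one' [of "a \<odot>\<^bsub>M\<^esub> \<zero>\<^bsub>M\<^esub>"] by auto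
qed

lemma smult_zero_left [simp]:
  assumes "x \<in> carrier M" shows "\<zero> \<odot>\<^bsub>M\<^esub> x = \<zero>\<^bsub>M\<^esub>"
proof -
  have "\<zero> \<odot>\<^bsub>M\<^esub> x \<oplus>\<^bsub>M\<^esub> \<zero> \<odot>\<^bsub>M\<^esub> x = \<zero> \<odot>\<^bsub>M\<^esub> x"
    using smult_l_distr[of \<zero> \<zero> x] assms by simp
  then show ?thesis using assms M.add.l_cancel_one' [of "\<zero> \<odot>\<^bsub>M\<^esub> x"] by auto
qed

lemma smult_minus_one:
  assumes "x \<in> carrier M" shows "(\<ominus> \<one>) \<odot>\<^bsub>M\<^esub> x = \<ominus>\<^bsub>M\<^esub> x"
proof -
  have "(\<ominus> \<one>) \<odot>\<^bsub>M\<^esub> x \<oplus>\<^bsub>M\<^esub> x = (\<ominus> \<one> \<oplus> \<one>) \<odot>\<^bsub>M\<^esub> x"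
    using smult_l_distr[of "\<ominus> \<one>" \<one> x] assms by simp
  also have "\<dots> = \<zero>\<^bsub>M\<^esub>" using assms by (simp add: R.l_neg)
  finally show ?thesis using assms M.minus_equality by simp
qed

lemma minus_eq_zeroD:
  assumes "x \<ominus>\<^bsub>M\<^esub> y = \<zero>\<^bsub>M\<^esub>" "x \<in> carrier M" "y \<in> carrier M"
  shows "x = y"
  using assms M.minus_equality[of x "\<ominus>\<^bsub>M\<^esub> y"] by (simp add: M.minus_eq)

text \<open>The locale \<open>submodule\<close> also asks for closure under additive inverses. That
  comes for free, because the inverse of x is the multiple of x by minus one.\<close>

lemma submodule_iff:
  "submodule L R M \<longleftrightarrow> L \<subseteq> carrier M \<and> \<zero>\<^bsub>M\<^esub> \<in> L \<and> (\<forall>x\<in>L. \<forall>y\<in>L. x \<oplus>\<^bsub>M\<^esub> y \<in> L) \<and>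
    (\<forall>a\<in>carrier R. \<forall>x\<in>L. a \<odot>\<^bsub>M\<^esub> x \<in> L)" (is "_ \<longleftrightarrow> ?r")
proof
  assume "submodule L R M"
  then interpret submodule L R M .
  show ?r using subset m_closed one_closed smult_closed by auto
next
  assume r: ?r
  have "\<ominus>\<^bsub>M\<^esub> x \<in> L" if "x \<in> L" for x
    using r that smult_minus_one[of x] R.a_inv_closed[OF R.one_closed] by (metis subsetD)
  then show "submodule L R M" using r
    by (unfold_locales) (auto simp: a_inv_def)
qed

lemma submodule_uminus:
  assumes "submodule L R M" "x \<in> L" shows "\<ominus>\<^bsub>M\<^esub> x \<in> L"
  using assms smult_minus_one[of x] R.a_inv_closed[OF R.one_closed]
  unfolding submodule_iff by (metis subsetD)

lemma submodule_subset: "submodule L R M \<Longrightarrow> L \<subseteq> carrier M"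
  and submodule_zero: "submodule L R M \<Longrightarrow> \<zero>\<^bsub>M\<^esub> \<in> L"
  and submodule_add: "submodule L R M \<Longrightarrow> x \<in> L \<Longrightarrow> y \<in> L \<Longrightarrow> x \<oplus>\<^bsub>M\<^esub> y \<in> L"
  and submodule_smult: "submodule L R M \<Longrightarrow> a \<in> carrier R \<Longrightarrow> x \<in> L \<Longrightarrow> a \<odot>\<^bsub>M\<^esub> x \<in> L"
  by (auto simp: submodule_iff)

lemma submodule_minus:
  "submodule L R M \<Longrightarrow> x \<in> L \<Longrightarrow> y \<in> L \<Longrightarrow> x \<ominus>\<^bsub>M\<^esub> y \<in> L"
  by (simp add: a_minus_def submodule_add submodule_uminus)

lemma submodule_carrier: "submodule (carrier M) R M"
  by (simp add: submodule_iff)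

lemma submodule_Int: "submodule A R M \<Longrightarrow> submodule B R M \<Longrightarrow> submodule (A \<inter> B) R M"
  by (auto simp: submodule_iff)

text \<open>The factor \<open>carrier M\<close> makes the empty index set give the whole module,
  matching the convention in \<open>irredundant\<close>.\<close>

lemma submodule_INT:
  "(\<And>i. i \<in> I \<Longrightarrow> submodule (Q i) R M) \<Longrightarrow> submodule (carrier M \<inter> (\<Inter>i\<in>I. Q i)) R M"
  by (auto simp: submodule_iff)

lemma submodule_set_add:
  assumes A: "submodule A R M" and B: "submodule B R M"
  shows "submodule (A <+>\<^bsub>M\<^esub> B) R M"
    and "A \<subseteq> A <+>\<^bsub>M\<^esub> B" and "B \<subseteq> A <+>\<^bsub>M\<^esub> B"
proof -
  note ss = submodule_subset[OF A, THEN subsetD] submodule_subset[OF B, THEN subsetD]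
  have mem: "x \<in> A <+>\<^bsub>M\<^esub> B \<longleftrightarrow> (\<exists>a\<in>A. \<exists>b\<in>B. x = a \<oplus>\<^bsub>M\<^esub> b)" for x
    by (auto simp: set_add_def')
  have z: "\<zero>\<^bsub>M\<^esub> \<in> A" "\<zero>\<^bsub>M\<^esub> \<in> B" using A B by (auto simp: submodule_iff)
  show sA: "A \<subseteq> A <+>\<^bsub>M\<^esub> B"
  proof
    fix a assume "a \<in> A"
    then have "a = a \<oplus>\<^bsub>M\<^esub> \<zero>\<^bsub>M\<^esub>" using ss by auto
    then show "a \<in> A <+>\<^bsub>M\<^esub> B" using z(2) \<open>a \<in> A\<close> unfolding mem by blast
  qed
  show "B \<subseteq> A <+>\<^bsub>M\<^esub> B"
  proof
    fix b assume "b \<in> B"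
    then have "b = \<zero>\<^bsub>M\<^esub> \<oplus>\<^bsub>M\<^esub> b" using ss by auto
    then show "b \<in> A <+>\<^bsub>M\<^esub> B" using z(1) \<open>b \<in> B\<close> unfolding mem by blast
  qed
  show "submodule (A <+>\<^bsub>M\<^esub> B) R M"
    unfolding submodule_iff
  proof (intro conjI ballI)
    show "A <+>\<^bsub>M\<^esub> B \<subseteq> carrier M" using ss by (auto simp: mem)
    show "\<zero>\<^bsub>M\<^esub> \<in> A <+>\<^bsub>M\<^esub> B" using z sA by auto
  next
    fix x y assume "x \<in> A <+>\<^bsub>M\<^esub> B" "y \<in> A <+>\<^bsub>M\<^esub> B"
    then obtain a b a' b' where *: "a \<in> A" "b \<in> B" "a' \<in> A" "b' \<in> B"
      "x = a \<oplus>\<^bsub>M\<^esub> b" "y = a' \<oplus>\<^bsub>M\<^esub> b'" unfolding mem by blast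
    then have "x \<oplus>\<^bsub>M\<^esub> y = (a \<oplus>\<^bsub>M\<^esub> a') \<oplus>\<^bsub>M\<^esub> (b \<oplus>\<^bsub>M\<^esub> b')" using ss by (simp add: M.a_ac)
    then show "x \<oplus>\<^bsub>M\<^esub> y \<in> A <+>\<^bsub>M\<^esub> B" unfolding mem using * A B by (meson submodule_iff)
  next
    fix r x assume r: "r \<in> carrier R" and "x \<in> A <+>\<^bsub>M\<^esub> B"
    then obtain a b where *: "a \<in> A" "b \<in> B" "x = a \<oplus>\<^bsub>M\<^esub> b" unfolding mem by blast
    then have "r \<odot>\<^bsub>M\<^esub> x = r \<odot>\<^bsub>M\<^esub> a \<oplus>\<^bsub>M\<^esub> r \<odot>\<^bsub>M\<^esub> b" using ss r by (simp add: smult_r_distr)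
    then show "r \<odot>\<^bsub>M\<^esub> x \<in> A <+>\<^bsub>M\<^esub> B" unfolding mem using * A B r by (meson submodule_iff)
  qed
qed

lemma submodule_cyclic:
  assumes "x \<in> carrier M"
  shows "submodule {a \<odot>\<^bsub>M\<^esub> x | a. a \<in> carrier R} R M" "x \<in> {a \<odot>\<^bsub>M\<^esub> x | a. a \<in> carrier R}"
proof -
  show "submodule {a \<odot>\<^bsub>M\<^esub> x | a. a \<in> carrier R} R M"
    unfolding submodule_iff
    apply (intro conjI ballI)
    using assms
    subgoal by auto
    subgoal using assms smult_zero_left R.zero_closed by (metis (mono_tags, lifting) mem_Collect_eq)
    subgoal using assms by clarsimp (metis smult_l_distr R.a_closed)
    subgoal using assms by clarsimp (metis smult_assoc1 R.m_closed)
    done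
  show "x \<in> {a \<odot>\<^bsub>M\<^esub> x | a. a \<in> carrier R}"
    using assms smult_one[of x] R.one_closed by (metis (mono_tags, lifting) mem_Collect_eq)
qed

text \<open>With this, the lemmas of the locale can be instantiated at a submodule regarded as a
  module in its own right.\<close>

lemma left_module_restrict:
  assumes "submodule U R M" shows "left_module R (restrict_to M U)"
proof -
  have s: "U \<subseteq> carrier M" using assms by (rule submodule_subset)
  have "abelian_group (restrict_to M U)"
  proof (rule abelian_groupI)
    fix x assume "x \<in> carrier (restrict_to M U)"
    then have "\<ominus>\<^bsub>M\<^esub> x \<in> U" "\<ominus>\<^bsub>M\<^esub> x \<oplus>\<^bsub>M\<^esub> x = \<zero>\<^bsub>M\<^esub>"
      using s submodule_uminus[OF assms] by (auto simp: M.l_neg)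
    then show "\<exists>y\<in>carrier (restrict_to M U). y \<oplus>\<^bsub>restrict_to M U\<^esub> x = \<zero>\<^bsub>restrict_to M U\<^esub>"
      by auto
  qed (use s assms in \<open>auto simp: submodule_iff subset_iff M.a_ac\<close>)
  then show ?thesis
    using s assms R.ring_axioms unfolding left_module_def left_module_axioms_def
    by (auto simp: submodule_iff subset_iff smult_l_distr smult_r_distr smult_assoc1)
qed

lemma submodule_restrict_iff:
  assumes "submodule U R M"
  shows "submodule L R (restrict_to M U) \<longleftrightarrow> submodule L R M \<and> L \<subseteq> U"
  using left_module.submodule_iff[OF left_module_restrict[OF assms]] submodule_iff
    submodule_subset[OF assms] by auto

section \<open>Uniform modules and uniform submodules\<close>

lemma uniform_module_iff:
  "uniform_module R M \<longleftrightarrow> carrier M \<noteq> {\<zero>\<^bsub>M\<^esub>} \<and>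
    (\<forall>A B. submodule A R M \<and> A \<noteq> {\<zero>\<^bsub>M\<^esub>} \<and> submodule B R M \<and> B \<noteq> {\<zero>\<^bsub>M\<^esub>} \<longrightarrow> A \<inter> B \<noteq> {\<zero>\<^bsub>M\<^esub>})"
  unfolding uniform_module_def essential_submodule_def by blast

text \<open>Submodules of the restricted module are the submodules of M lying in U. Later arguments
  can therefore stay inside M and never mention \<open>restrict_to\<close>.\<close>

lemma uniform_submodule_iff:
  "uniform_submodule R M U \<longleftrightarrow> submodule U R M \<and> U \<noteq> {\<zero>\<^bsub>M\<^esub>} \<and>
    (\<forall>A B. submodule A R M \<and> A \<subseteq> U \<and> A \<noteq> {\<zero>\<^bsub>M\<^esub>} \<and> submodule B R M \<and> B \<subseteq> U \<and> B \<noteq> {\<zero>\<^bsub>M\<^esub>}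
      \<longrightarrow> A \<inter> B \<noteq> {\<zero>\<^bsub>M\<^esub>})"
proof (cases "submodule U R M")
  case True
  show ?thesis unfolding uniform_submodule_def
    left_module.uniform_module_iff[OF left_module_restrict[OF True]] submodule_restrict_iff[OF True]
    using True by auto
qed (simp add: uniform_submodule_def)

lemma submodule_nonzeroE:
  assumes "submodule L R M" "L \<noteq> {\<zero>\<^bsub>M\<^esub>}"
  obtains x where "x \<in> L" "x \<noteq> \<zero>\<^bsub>M\<^esub>"
  using assms submodule_zero by blast

text \<open>The cyclic submodule generated by w is nonzero and lies in U, so by uniformity it meets
  the nonzero submodule \<open>U \<inter> E\<close>. This turns uniformity into a statement about
  multiples of single elements.\<close>

lemma uniform_smult_mem:
  assumes U: "uniform_submodule R M U" and E: "submodule E R M" "U \<inter> E \<noteq> {\<zero>\<^bsub>M\<^esub>}"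
    and w: "w \<in> U" "w \<noteq> \<zero>\<^bsub>M\<^esub>"
  obtains r where "r \<in> carrier R" "r \<odot>\<^bsub>M\<^esub> w \<in> E" "r \<odot>\<^bsub>M\<^esub> w \<noteq> \<zero>\<^bsub>M\<^esub>"
proof -
  let ?C = "{a \<odot>\<^bsub>M\<^esub> w | a. a \<in> carrier R}"
  have sU: "submodule U R M" using U by (simp add: uniform_submodule_iff)
  have wc: "w \<in> carrier M" using w sU submodule_subset by auto
  note C = submodule_cyclic[OF wc]
  have "?C \<subseteq> U" using w sU by (auto simp: submodule_iff)
  moreover have "?C \<noteq> {\<zero>\<^bsub>M\<^esub>}" using C(2) w by blast
  moreover have UE: "submodule (U \<inter> E) R M" using sU E submodule_Int by auto
  ultimately have ne: "?C \<inter> (U \<inter> E) \<noteq> {\<zero>\<^bsub>M\<^esub>}"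
    using U C(1) E(2) unfolding uniform_submodule_iff by blast
  from submodule_nonzeroE[OF submodule_Int[OF C(1) UE] ne]
  show ?thesis using that by blast
qed

subsection \<open>Direct sums\<close>

lemma submodule_finsum:
  assumes "submodule L R M" "finite J" "x \<in> J \<rightarrow> L"
  shows "finsum M x J \<in> L"
  using assms(2,3)
proof (induction J)
  case empty
  then show ?case using submodule_zero[OF assms(1)] by simp
next
  case (insert j J)
  then have "x \<in> J \<rightarrow> carrier M" "x j \<in> carrier M" using submodule_subset[OF assms(1)] by auto
  then show ?case using insert submodule_add[OF assms(1)] by auto
qed

lemma smult_finsum:
  assumes "r \<in> carrier R" "finite J" "x \<in> J \<rightarrow> carrier M"
  shows "r \<odot>\<^bsub>M\<^esub> finsum M x J = finsum M (\<lambda>i. r \<odot>\<^bsub>M\<^esub> x i) J"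
  using assms(2,3)
proof (induction J)
  case (insert j J)
  then have "x \<in> J \<rightarrow> carrier M" "x j \<in> carrier M" by auto
  moreover have "(\<lambda>i. r \<odot>\<^bsub>M\<^esub> x i) \<in> J \<rightarrow> carrier M" using insert assms(1) by auto
  ultimately show ?case using insert assms(1) by (simp add: smult_r_distr)
qed (simp add: assms)

text \<open>The definition of \<open>submodule_sum\<close> admits sums over any finite subset of the
  index set. For finite I such a sum can be padded with zeros to one over all of I.\<close>

lemma mem_submodule_sum_iff:
  assumes "finite I" "\<forall>i\<in>I. submodule (L i) R M"
  shows "y \<in> submodule_sum M I L \<longleftrightarrow> (\<exists>x \<in> Pi I L. y = finsum M x I)"
proof
  assume "y \<in> submodule_sum M I L"
  then obtain x J where J: "finite J" "J \<subseteq> I" "x \<in> Pi J L" "y = finsum M x J"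
    unfolding submodule_sum_def by blast
  let ?x = "\<lambda>i. if i \<in> J then x i else \<zero>\<^bsub>M\<^esub>"
  have c: "x i \<in> carrier M" if "i \<in> J" for i
    using that J assms(2) submodule_subset[of "L i"] by auto
  have "finsum M ?x I = finsum M x J"
    using J assms(1) c by (intro M.add.finprod_mono_neutral_cong_right) auto
  moreover have "?x \<in> Pi I L" using J assms(2) by (auto simp: submodule_iff)
  ultimately show "\<exists>x \<in> Pi I L. y = finsum M x I" using J by metis
qed (use assms in \<open>auto simp: submodule_sum_def\<close>)

lemma submodule_submodule_sum:
  assumes "finite I" "\<And>i. i \<in> I \<Longrightarrow> submodule (L i) R M"
  shows "submodule (submodule_sum M I L) R M"
proof -
  have c: "x i \<in> carrier M" if "i \<in> I" "x \<in> Pi I L" for x i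
    using that assms(2)[of i] submodule_subset[of "L i"] by auto
  have sub: "\<forall>i\<in>I. submodule (L i) R M" using assms by blast
  note mem = mem_submodule_sum_iff[OF assms(1) sub]
  show ?thesis unfolding submodule_iff
  proof (intro conjI ballI)
    show "submodule_sum M I L \<subseteq> carrier M" using c by (auto simp: mem intro!: M.finsum_closed)
    show "\<zero>\<^bsub>M\<^esub> \<in> submodule_sum M I L" using submodule_zero assms(2)
      unfolding mem
      by (intro bexI[of _ "\<lambda>_. \<zero>\<^bsub>M\<^esub>"]) auto
  next
    fix y z assume "y \<in> submodule_sum M I L" "z \<in> submodule_sum M I L"
    then obtain x x' where x: "x \<in> Pi I L" "x' \<in> Pi I L" "y = finsum M x I" "z = finsum M x' I"
      by (auto simp: mem)
    have "y \<oplus>\<^bsub>M\<^esub> z = (\<Oplus>\<^bsub>M\<^esub>i\<in>I. x i \<oplus>\<^bsub>M\<^esub> x' i)" 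
      unfolding x by (intro M.finsum_addf[symmetric]) (use x c in auto)
    moreover have "(\<lambda>i. x i \<oplus>\<^bsub>M\<^esub> x' i) \<in> Pi I L" using x sub by (auto intro!: submodule_add)
    ultimately show "y \<oplus>\<^bsub>M\<^esub> z \<in> submodule_sum M I L" unfolding mem by blast
  next
    fix r y assume r: "r \<in> carrier R" and "y \<in> submodule_sum M I L"
    then obtain x where x: "x \<in> Pi I L" "y = finsum M x I"
      by (auto simp: mem)
    have "r \<odot>\<^bsub>M\<^esub> y = (\<Oplus>\<^bsub>M\<^esub>i\<in>I. r \<odot>\<^bsub>M\<^esub> x i)" using x c r assms(1) by (auto intro!: smult_finsum)
    moreover have "(\<lambda>i. r \<odot>\<^bsub>M\<^esub> x i) \<in> Pi I L" using x r sub by (auto intro!: submodule_smult)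
    ultimately show "r \<odot>\<^bsub>M\<^esub> y \<in> submodule_sum M I L" unfolding mem by blast
  qed
qed

lemma submodule_sum_superset:
  assumes "i \<in> I" "submodule (L i) R M"
  shows "L i \<subseteq> submodule_sum M I L"
proof
  fix y assume "y \<in> L i"
  then have "y = finsum M (\<lambda>_. y) {i}" using assms submodule_subset[of "L i"] by (subst M.finsum_insert) auto
  then show "y \<in> submodule_sum M I L" unfolding submodule_sum_def using assms \<open>y \<in> L i\<close>
    by (intro CollectI exI[of _ "\<lambda>_. y"] exI[of _ "{i}"]) auto
qed

text \<open>Isolating one term of a vanishing sum places it in its own summand and in the sum of the
  others; conversely, an element of both yields a vanishing sum. This linear independence criterion
  is the working form of directness for finite families.\<close>

lemma direct_family_iff:
  assumes "finite I" "\<forall>i\<in>I. submodule (L i) R M"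
  shows "direct_family M I L \<longleftrightarrow> (\<forall>x\<in>Pi I L. finsum M x I = \<zero>\<^bsub>M\<^esub> \<longrightarrow> (\<forall>i\<in>I. x i = \<zero>\<^bsub>M\<^esub>))"
proof -
  have c: "x i \<in> carrier M" if "i \<in> I" "x \<in> Pi I L" for x i
    using that assms(2) submodule_subset[of "L i"] by auto
  have mem: "y \<in> submodule_sum M (I - {i}) L \<longleftrightarrow> (\<exists>x \<in> Pi (I - {i}) L. y = finsum M x (I - {i}))" for i y
    by (rule mem_submodule_sum_iff) (use assms in auto)
  show ?thesis
  proof (intro iffI ballI impI)
    fix x i assume d: "direct_family M I L" and x: "x \<in> Pi I L" "finsum M x I = \<zero>\<^bsub>M\<^esub>" and i: "i \<in> I"
    have I: "I = insert i (I - {i})" using i by auto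
    have cc: "x \<in> (I - {i}) \<rightarrow> carrier M" "x i \<in> carrier M" using c x i by auto
    have "finsum M x I = x i \<oplus>\<^bsub>M\<^esub> finsum M x (I - {i})"
      by (subst I, rule M.finsum_insert) (use assms cc in auto)
    then have "x i = \<ominus>\<^bsub>M\<^esub> finsum M x (I - {i})"
      using x cc M.minus_equality[of "x i" "finsum M x (I - {i})"] by simp
    moreover have "finsum M x (I - {i}) \<in> submodule_sum M (I - {i}) L"
      using x unfolding mem by auto
    moreover have "submodule (submodule_sum M (I - {i}) L) R M"
      by (rule submodule_submodule_sum) (use assms in auto)
    ultimately have "x i \<in> L i \<inter> submodule_sum M (I - {i}) L"
      using submodule_uminus[of "submodule_sum M (I - {i}) L" "finsum M x (I - {i})"] Pi_mem[OF x(1) i]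
      by auto
    then show "x i = \<zero>\<^bsub>M\<^esub>" using d i unfolding direct_family_def by auto
  next
    assume r: "\<forall>x\<in>Pi I L. finsum M x I = \<zero>\<^bsub>M\<^esub> \<longrightarrow> (\<forall>i\<in>I. x i = \<zero>\<^bsub>M\<^esub>)"
    show "direct_family M I L" unfolding direct_family_def
    proof (intro ballI equalityI subsetI)
      fix i y assume i: "i \<in> I" and y: "y \<in> L i \<inter> submodule_sum M (I - {i}) L"
      then obtain x where x: "x \<in> Pi (I - {i}) L" "y = finsum M x (I - {i})" using mem by auto
      \<comment> \<open>Putting minus y in position i cancels the sum y of the other terms, so the
        independence criterion applies to this family.\<close>
      let ?x = "x(i := \<ominus>\<^bsub>M\<^esub> y)"
      have yc: "y \<in> carrier M" using y i assms(2) submodule_subset by auto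
      have P: "?x \<in> Pi I L" using x y i assms(2) submodule_uminus by auto
      have xc: "x j \<in> carrier M" if "j \<in> I - {i}" for j using c[OF _ P, of j] that by auto
      have I: "I = insert i (I - {i})" using i by auto
      have "finsum M ?x I = ?x i \<oplus>\<^bsub>M\<^esub> finsum M ?x (I - {i})"
        by (subst I, rule M.finsum_insert) (use assms(1) c[OF _ P] i in blast)+
      also have "finsum M ?x (I - {i}) = finsum M x (I - {i})"
        using xc by (intro M.finsum_cong') auto
      also have "?x i \<oplus>\<^bsub>M\<^esub> finsum M x (I - {i}) = \<zero>\<^bsub>M\<^esub>" using x yc by (simp add: M.l_neg)
      finally have "?x i = \<zero>\<^bsub>M\<^esub>" using r P i by blast
      then show "y \<in> {\<zero>\<^bsub>M\<^esub>}" using yc M.r_neg[of y] by simp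
    next
      fix i y assume i: "i \<in> I" and y: "y \<in> {\<zero>\<^bsub>M\<^esub>}"
      have "submodule (submodule_sum M (I - {i}) L) R M"
        by (rule submodule_submodule_sum) (use assms in auto)
      then show "y \<in> L i \<inter> submodule_sum M (I - {i}) L" using y i assms submodule_zero by auto
    qed
  qed
qed

lemma direct_family_subset:
  assumes "direct_family M I L" "J \<subseteq> I" "\<And>i. i \<in> I \<Longrightarrow> submodule (L i) R M"
  shows "direct_family M J L"
  unfolding direct_family_def
proof (intro ballI equalityI subsetI)
  fix i y assume "i \<in> J" "y \<in> L i \<inter> submodule_sum M (J - {i}) L"
  moreover have "submodule_sum M (J - {i}) L \<subseteq> submodule_sum M (I - {i}) L"
    using assms(2) unfolding submodule_sum_def by blast
  ultimately show "y \<in> {\<zero>\<^bsub>M\<^esub>}" using assms unfolding direct_family_def by blast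
next
  fix i y assume "i \<in> J" "y \<in> {\<zero>\<^bsub>M\<^esub>}"
  moreover have "\<zero>\<^bsub>M\<^esub> \<in> submodule_sum M (J - {i}) L" unfolding submodule_sum_def
    by (intro CollectI exI[of _ "\<lambda>_. \<zero>\<^bsub>M\<^esub>"] exI[of _ "{}"]) auto
  ultimately show "y \<in> L i \<inter> submodule_sum M (J - {i}) L" using assms submodule_zero by blast
qed

text \<open>In a vanishing sum the component in X is minus a sum of components from the other
  \<open>L i\<close>, so it lies in the intersection assumed to be zero. What is left is a relation
  in the old family.\<close>

lemma direct_family_replace:
  assumes I: "finite I" "\<And>i. i \<in> I \<Longrightarrow> submodule (L i) R M" and d: "direct_family M I L"
    and k: "k \<in> I" and X: "submodule X R M" "X \<inter> submodule_sum M (I - {k}) L = {\<zero>\<^bsub>M\<^esub>}"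
  shows "direct_family M I (L(k := X))"
proof -
  have sub: "submodule ((L(k := X)) i) R M" if "i \<in> I" for i using that I X by auto
  have IK: "I = insert k (I - {k})" using k by auto
  have sub': "\<forall>i\<in>I. submodule ((L(k := X)) i) R M" and subL: "\<forall>i\<in>I. submodule (L i) R M"
    using sub I by blast+
  show ?thesis unfolding direct_family_iff[OF I(1) sub']
  proof (intro ballI impI)
    fix x i assume x: "x \<in> Pi I (L(k := X))" "finsum M x I = \<zero>\<^bsub>M\<^esub>" and i: "i \<in> I"
    have c: "x j \<in> carrier M" if "j \<in> I" for j
      using that x(1) submodule_subset[OF sub[OF that]] by (meson PiE subsetD)
    have x': "x \<in> Pi (I - {k}) L" using x by (auto simp: Pi_iff split: if_splits)
    have "finsum M x I = x k \<oplus>\<^bsub>M\<^esub> finsum M x (I - {k})"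
      by (subst IK, rule M.finsum_insert) (use I c k in auto)
    then have "x k = \<ominus>\<^bsub>M\<^esub> finsum M x (I - {k})"
      using x c k M.minus_equality[of "x k" "finsum M x (I - {k})"] by simp
    moreover have "finsum M x (I - {k}) \<in> submodule_sum M (I - {k}) L"
      using x' I unfolding submodule_sum_def by blast
    moreover have "submodule (submodule_sum M (I - {k}) L) R M"
      by (rule submodule_submodule_sum) (use I in auto)
    moreover have "x k \<in> X" using x k by (auto dest!: Pi_mem)
    ultimately have xk: "x k = \<zero>\<^bsub>M\<^esub>" using X(2) submodule_uminus by fastforce
    \<comment> \<open>A zero k-th component belongs to \<open>L k\<close> as well as to X, so x is
      also a choice of components for the original family.\<close>
    then have "x \<in> Pi I L" using x' I k submodule_zero by fastforce
    then show "x i = \<zero>\<^bsub>M\<^esub>" using d x i unfolding direct_family_iff[OF I(1) subL] by blast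
  qed
qed

text \<open>If \<open>a y \<in> E\<close> is a nonzero multiple of \<open>y\<close>, directness keeps every multiple of \<open>a (w + y)\<close>
  with nonzero \<open>w\<close>-component nonzero, so the summands may be treated one after the other.\<close>

lemma direct_sum_smult_mem:
  assumes "finite J" "\<And>j. j \<in> J \<Longrightarrow> uniform_submodule R M (W j)" "direct_family M J W"
    and E: "submodule E R M" "\<And>j. j \<in> J \<Longrightarrow> W j \<inter> E \<noteq> {\<zero>\<^bsub>M\<^esub>}"
    and "x \<in> Pi J W" "finsum M x J \<noteq> \<zero>\<^bsub>M\<^esub>"
  shows "\<exists>r\<in>carrier R. r \<odot>\<^bsub>M\<^esub> finsum M x J \<in> E \<and> r \<odot>\<^bsub>M\<^esub> finsum M x J \<noteq> \<zero>\<^bsub>M\<^esub>"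
  using assms(1-3,5-)
proof (induction J arbitrary: x)
  case empty
  then show ?case by simp
next
  case (insert j J)
  have sub: "submodule (W i) R M" if "i \<in> insert j J" for i
    using insert.prems(1)[OF that] by (simp add: uniform_submodule_iff)
  have c: "x i \<in> carrier M" if "i \<in> insert j J" for i
    using that insert.prems(4) sub[OF that] submodule_subset by auto
  define y w where "y = finsum M x J" and "w = x j"
  have yc: "y \<in> carrier M" "w \<in> carrier M" using c unfolding y_def w_def by auto
  have wW: "w \<in> W j" using insert.prems(4) w_def by auto
  have sum: "finsum M x (insert j J) = w \<oplus>\<^bsub>M\<^esub> y" using c insert.hyps y_def w_def by (simp add: Pi_iff)
  have w_mult: "\<exists>t\<in>carrier R. t \<odot>\<^bsub>M\<^esub> v \<in> E \<and> t \<odot>\<^bsub>M\<^esub> v \<noteq> \<zero>\<^bsub>M\<^esub>"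
    if "v \<in> W j" "v \<noteq> \<zero>\<^bsub>M\<^esub>" for v
    using that uniform_smult_mem[OF insert.prems(1)[of j] E(1) insert.prems(3)[of j]] by blast
  show ?case
  proof (cases "y = \<zero>\<^bsub>M\<^esub>")
    case True
    then show ?thesis using w_mult[of w] wW insert.prems(5) yc unfolding sum by simp
  next
    case False
    have xJ: "x \<in> Pi J W" using insert.prems(4) by auto
    have "direct_family M J W" by (rule direct_family_subset[OF insert.prems(2)]) (use sub in auto)
    then have "\<exists>r\<in>carrier R. r \<odot>\<^bsub>M\<^esub> y \<in> E \<and> r \<odot>\<^bsub>M\<^esub> y \<noteq> \<zero>\<^bsub>M\<^esub>"
      using insert.IH[of x] insert.prems xJ False unfolding y_def by blast
    then obtain a where a: "a \<in> carrier R" "a \<odot>\<^bsub>M\<^esub> y \<in> E" "a \<odot>\<^bsub>M\<^esub> y \<noteq> \<zero>\<^bsub>M\<^esub>" by blast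
    show ?thesis
    \<comment> \<open>If a annihilates w, then a itself works for w + y. Otherwise a further factor
      t brings aw into E with taw nonzero; tay stays in E, although it may become zero.\<close>
    proof (cases "a \<odot>\<^bsub>M\<^esub> w = \<zero>\<^bsub>M\<^esub>")
      case True
      then have "a \<odot>\<^bsub>M\<^esub> finsum M x (insert j J) = a \<odot>\<^bsub>M\<^esub> y" using a yc
        unfolding sum by (simp add: smult_r_distr)
      then show ?thesis using a by metis
    next
      case False
      moreover have "a \<odot>\<^bsub>M\<^esub> w \<in> W j" using wW a sub submodule_smult by auto
      ultimately obtain t where t: "t \<in> carrier R" "t \<odot>\<^bsub>M\<^esub> (a \<odot>\<^bsub>M\<^esub> w) \<in> E" "t \<odot>\<^bsub>M\<^esub> (a \<odot>\<^bsub>M\<^esub> w) \<noteq> \<zero>\<^bsub>M\<^esub>"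
        using w_mult by blast
      have ta: "t \<otimes> a \<in> carrier R" using t a by simp
      have eq: "(t \<otimes> a) \<odot>\<^bsub>M\<^esub> finsum M x (insert j J) = t \<odot>\<^bsub>M\<^esub> (a \<odot>\<^bsub>M\<^esub> w) \<oplus>\<^bsub>M\<^esub> t \<odot>\<^bsub>M\<^esub> (a \<odot>\<^bsub>M\<^esub> y)"
        using a t yc unfolding sum by (simp add: smult_r_distr smult_assoc1)
      have "(t \<otimes> a) \<odot>\<^bsub>M\<^esub> finsum M x (insert j J) \<in> E"
        unfolding eq using a t E(1) by (simp add: submodule_add submodule_smult)
      moreover have "(t \<otimes> a) \<odot>\<^bsub>M\<^esub> finsum M x (insert j J) \<noteq> \<zero>\<^bsub>M\<^esub>"
      proof
        assume z: "(t \<otimes> a) \<odot>\<^bsub>M\<^esub> finsum M x (insert j J) = \<zero>\<^bsub>M\<^esub>"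
        have "(t \<otimes> a) \<odot>\<^bsub>M\<^esub> finsum M x (insert j J) = finsum M (\<lambda>i. (t \<otimes> a) \<odot>\<^bsub>M\<^esub> x i) (insert j J)"
          using ta insert.hyps c by (intro smult_finsum) auto
        moreover have "(\<lambda>i. (t \<otimes> a) \<odot>\<^bsub>M\<^esub> x i) \<in> Pi (insert j J) W"
          using sub insert.prems(4) ta by (auto intro!: submodule_smult)
        moreover have fin: "finite (insert j J)" "\<forall>i\<in>insert j J. submodule (W i) R M"
          using insert.hyps sub by blast+
        ultimately have "(t \<otimes> a) \<odot>\<^bsub>M\<^esub> w = \<zero>\<^bsub>M\<^esub>"
          using insert.prems(2) z
          unfolding direct_family_iff[OF fin] w_def by auto
        then show False using t a yc by (simp add: smult_assoc1)
      qed
      ultimately show ?thesis using ta by blast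
    qed
  qed
qed

text \<open>A nonzero submodule L contains a nonzero element of the essential direct sum. Some
  multiple of that element is nonzero and lies in E, and it still lies in L.\<close>

lemma essential_if_meets_uniform_summands:
  assumes "finite J" "\<And>j. j \<in> J \<Longrightarrow> uniform_submodule R M (W j)" "direct_family M J W"
    and ess: "essential_submodule R M (submodule_sum M J W)"
    and E: "submodule E R M" "\<And>j. j \<in> J \<Longrightarrow> W j \<inter> E \<noteq> {\<zero>\<^bsub>M\<^esub>}"
  shows "essential_submodule R M E"
  unfolding essential_submodule_def
proof (intro conjI allI impI E(1))
  fix L assume L: "submodule L R M \<and> L \<noteq> {\<zero>\<^bsub>M\<^esub>}"
  have sub: "submodule (W i) R M" if "i \<in> J" for i
    using assms(2)[OF that] by (simp add: uniform_submodule_iff)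
  have ne: "submodule_sum M J W \<inter> L \<noteq> {\<zero>\<^bsub>M\<^esub>}"
    using ess L unfolding essential_submodule_def by blast
  have "submodule (submodule_sum M J W \<inter> L) R M"
    using ess L unfolding essential_submodule_def by (blast intro: submodule_Int)
  from submodule_nonzeroE[OF this ne] obtain y
    where y: "y \<in> submodule_sum M J W" "y \<in> L" "y \<noteq> \<zero>\<^bsub>M\<^esub>" by auto
  have "\<forall>i\<in>J. submodule (W i) R M" using sub by blast
  then obtain x where x: "x \<in> Pi J W" "y = finsum M x J"
    using y(1) mem_submodule_sum_iff[OF assms(1)] by blast
  then obtain r where "r \<in> carrier R" "r \<odot>\<^bsub>M\<^esub> y \<in> E" "r \<odot>\<^bsub>M\<^esub> y \<noteq> \<zero>\<^bsub>M\<^esub>"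
    using direct_sum_smult_mem[OF assms(1-3) E x(1)] y(3) by blast
  then show "E \<inter> L \<noteq> {\<zero>\<^bsub>M\<^esub>}" using y L submodule_smult[of L r y] by blast
qed

subsection \<open>Uniform dimension\<close>

text \<open>Steinitz exchange, one position at a time. The sum S of all members but the k-th misses
  the nonzero \<open>U k\<close>, so S is not essential. By
  \<open>essential_if_meets_uniform_summands\<close> some \<open>W j\<close> then misses S, and it
  can take the place of \<open>U k\<close>.\<close>

lemma direct_family_exchange:
  fixes k m n :: nat
  assumes U: "\<And>i. i < n \<Longrightarrow> submodule (U i) R M" "\<And>i. i < n \<Longrightarrow> U i \<noteq> {\<zero>\<^bsub>M\<^esub>}" "direct_family M {..<n} U"
    and W: "\<And>j. j < m \<Longrightarrow> uniform_submodule R M (W j)" "direct_family M {..<m} W"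
      "essential_submodule R M (submodule_sum M {..<m} W)"
    and "k \<le> n"
  shows "\<exists>h. h \<in> {..<k} \<rightarrow> {..<m} \<and> direct_family M {..<n} (\<lambda>i. if i < k then W (h i) else U i)"
  using assms(7)
proof (induction k)
  case 0
  then show ?case using U by auto
next
  case (Suc k)
  then obtain h where h: "h \<in> {..<k} \<rightarrow> {..<m}" "direct_family M {..<n} (\<lambda>i. if i < k then W (h i) else U i)"
    by auto
  define F where "F = (\<lambda>i. if i < k then W (h i) else U i)"
  have subW: "submodule (W j) R M" if "j < m" for j using W(1)[OF that] by (simp add: uniform_submodule_iff)
  have subF: "submodule (F i) R M" if "i \<in> {..<n}" for i
    using that h U subW unfolding F_def by auto
  have k: "k \<in> {..<n}" using Suc.prems by auto
  define S where "S = submodule_sum M ({..<n} - {k}) F"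
  have S: "submodule S R M" unfolding S_def by (rule submodule_submodule_sum) (use subF in auto)
  \<comment> \<open>Position k has not been exchanged yet, so \<open>F k\<close> is still
    \<open>U k\<close>, and directness of F applies to it.\<close>
  have "U k \<inter> S = {\<zero>\<^bsub>M\<^esub>}" using h(2) k unfolding S_def F_def direct_family_def by force
  then have "\<not> essential_submodule R M S"
    using U(1,2)[of k] k unfolding essential_submodule_def by (metis inf_commute lessThan_iff)
  then have "\<exists>j<m. W j \<inter> S = {\<zero>\<^bsub>M\<^esub>}"
    using essential_if_meets_uniform_summands[of "{..<m}" W S] W S by auto
  then obtain j where j: "j < m" "W j \<inter> S = {\<zero>\<^bsub>M\<^esub>}" by blast
  have "direct_family M {..<n} (F(k := W j))"
    by (rule direct_family_replace) (use subF k subW[OF j(1)] j(2) h(2) in \<open>auto simp: S_def F_def\<close>)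
  moreover have "F(k := W j) = (\<lambda>i. if i < Suc k then W ((h(k := j)) i) else U i)"
    by (auto simp: F_def fun_eq_iff less_Suc_eq)
  moreover have "h(k := j) \<in> {..<Suc k} \<rightarrow> {..<m}" using h(1) j by (auto simp: less_Suc_eq)
  ultimately show ?case by metis
qed

text \<open>After exchanging all n members, the chosen indices must be distinct: if a nonzero
  \<open>W j\<close> occurred at two positions, it would lie in the sum of the other members,
  against directness. So there are n different indices below m.\<close>

lemma card_direct_family_le:
  fixes m n :: nat
  assumes U: "\<And>i. i < n \<Longrightarrow> submodule (U i) R M" "\<And>i. i < n \<Longrightarrow> U i \<noteq> {\<zero>\<^bsub>M\<^esub>}" "direct_family M {..<n} U"
    and W: "\<And>j. j < m \<Longrightarrow> uniform_submodule R M (W j)" "direct_family M {..<m} W"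
      "essential_submodule R M (submodule_sum M {..<m} W)"
  shows "n \<le> m"
proof -
  obtain h where h: "h \<in> {..<n} \<rightarrow> {..<m}" "direct_family M {..<n} (\<lambda>i. if i < n then W (h i) else U i)"
    using direct_family_exchange[of n U m W n] assms by blast
  have "inj_on h {..<n}"
  proof (rule inj_onI, rule ccontr)
    fix a b assume ab: "a \<in> {..<n}" "b \<in> {..<n}" "h a = h b" "a \<noteq> b"
    have u: "uniform_submodule R M (W (h a))" using ab h W by auto
    let ?F = "\<lambda>i. if i < n then W (h i) else U i"
    have "?F b \<subseteq> submodule_sum M ({..<n} - {a}) ?F"
      by (rule submodule_sum_superset) (use ab u in \<open>auto simp: uniform_submodule_iff\<close>)
    moreover have "?F a \<inter> submodule_sum M ({..<n} - {a}) ?F = {\<zero>\<^bsub>M\<^esub>}"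
      using h(2) ab unfolding direct_family_def by blast
    ultimately have "W (h a) = {\<zero>\<^bsub>M\<^esub>}" using ab by auto
    then show False using u by (simp add: uniform_submodule_iff)
  qed
  then show ?thesis using h(1) by (metis card_inj_on_le card_lessThan finite_lessThan image_subset_iff_funcset)
qed

text \<open>Applying \<open>card_direct_family_le\<close> in both directions supplies the uniqueness
  needed to evaluate the definite description in \<open>udim\<close>.\<close>

lemma udim_eqI:
  fixes n :: nat
  assumes "\<And>i. i < n \<Longrightarrow> uniform_submodule R M (U i)" "direct_family M {..<n} U"
    "essential_submodule R M (submodule_sum M {..<n} U)"
  shows "udim R M = n"
  unfolding udim_def
proof (rule the_equality)
  fix m :: nat assume "\<exists>U :: nat \<Rightarrow> _ set. (\<forall>i<m. uniform_submodule R M (U i)) \<and> direct_family M {..<m} U \<and>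
       essential_submodule R M (submodule_sum M {..<m} U)"
  then obtain W where W: "\<And>i. i < m \<Longrightarrow> uniform_submodule R M (W i)" "direct_family M {..<m} W"
       "essential_submodule R M (submodule_sum M {..<m} W)" by blast
  have "n \<le> m" by (rule card_direct_family_le[of n U m W]) (use assms W in \<open>auto simp: uniform_submodule_iff\<close>)
  moreover have "m \<le> n" by (rule card_direct_family_le[of m W n U]) (use assms W in \<open>auto simp: uniform_submodule_iff\<close>)
  ultimately show "m = n" by simp
qed (use assms in blast)

subsection \<open>Meet-irreducible submodules\<close>

lemma essential_submodule_Int:
  assumes "essential_submodule R M A" "essential_submodule R M B"
  shows "essential_submodule R M (A \<inter> B)"
  using assms submodule_Int unfolding essential_submodule_def by (metis inf_assoc)

lemma essential_submodule_INT:
  assumes "finite I" "\<And>i. i \<in> I \<Longrightarrow> essential_submodule R M (E i)"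
  shows "essential_submodule R M (carrier M \<inter> (\<Inter>i\<in>I. E i))"
  using assms
proof (induction I)
  case empty
  have "carrier M \<inter> L = L" if "submodule L R M" for L using submodule_subset[OF that] by blast
  then show ?case using submodule_carrier by (simp add: essential_submodule_def)
next
  case (insert i I)
  have "carrier M \<inter> (\<Inter>j\<in>insert i I. E j) = E i \<inter> (carrier M \<inter> (\<Inter>j\<in>I. E j))" by auto
  then show ?case using insert essential_submodule_Int by simp
qed

lemma essential_submodule_mono:
  assumes "essential_submodule R M A" "A \<subseteq> B" "submodule B R M"
  shows "essential_submodule R M B"
  unfolding essential_submodule_def
proof (intro conjI allI impI assms(3))
  fix L assume L: "submodule L R M \<and> L \<noteq> {\<zero>\<^bsub>M\<^esub>}"
  then have "A \<inter> L \<noteq> {\<zero>\<^bsub>M\<^esub>}" "\<zero>\<^bsub>M\<^esub> \<in> A \<inter> L"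
    using assms(1) submodule_zero unfolding essential_submodule_def by blast+
  then show "B \<inter> L \<noteq> {\<zero>\<^bsub>M\<^esub>}" using assms(2) by blast
qed

text \<open>Both A + Q and B + Q properly contain Q, so they share an element x outside Q. Writing x
  as a + q and as b + q' gives elements a and b that agree modulo Q. In other words, the images of A
  and B in M/Q have a common nonzero element.\<close>

lemma meet_irreducibleE:
  assumes Q: "meet_irreducible R M Q" and A: "submodule A R M" "\<not> A \<subseteq> Q"
    and B: "submodule B R M" "\<not> B \<subseteq> Q"
  obtains a b where "a \<in> A" "b \<in> B" "a \<notin> Q" "a \<ominus>\<^bsub>M\<^esub> b \<in> Q"
proof -
  have sQ: "submodule Q R M" using Q by (simp add: meet_irreducible_def)
  note AQ = submodule_set_add[OF A(1) sQ] and BQ = submodule_set_add[OF B(1) sQ]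
  have "Q \<subset> A <+>\<^bsub>M\<^esub> Q" "Q \<subset> B <+>\<^bsub>M\<^esub> Q" using AQ BQ A B by blast+
  then have "(A <+>\<^bsub>M\<^esub> Q) \<inter> (B <+>\<^bsub>M\<^esub> Q) \<noteq> Q"
    using Q AQ(1) BQ(1) unfolding meet_irreducible_def by blast
  then obtain x where x: "x \<in> A <+>\<^bsub>M\<^esub> Q" "x \<in> B <+>\<^bsub>M\<^esub> Q" "x \<notin> Q" using AQ(3) BQ(3) by blast
  then obtain a q b q' where *: "a \<in> A" "q \<in> Q" "b \<in> B" "q' \<in> Q"
    "x = a \<oplus>\<^bsub>M\<^esub> q" "a \<oplus>\<^bsub>M\<^esub> q = b \<oplus>\<^bsub>M\<^esub> q'"
    unfolding set_add_def' by blast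
  have c: "a \<in> carrier M" "q \<in> carrier M" "b \<in> carrier M" "q' \<in> carrier M"
    using * A(1) B(1) sQ submodule_subset by blast+
  have "a = (b \<oplus>\<^bsub>M\<^esub> q') \<ominus>\<^bsub>M\<^esub> q" using *(6) c by (simp add: M.minus_eq M.a_assoc M.r_neg flip: *(6))
  then have "a \<ominus>\<^bsub>M\<^esub> b = q' \<ominus>\<^bsub>M\<^esub> q"
    using c by (simp add: M.minus_eq M.a_assoc M.a_lcomm[of b q'] M.a_comm[of "\<ominus>\<^bsub>M\<^esub> q"] M.r_neg2)
  moreover have "q' \<ominus>\<^bsub>M\<^esub> q \<in> Q" using * sQ submodule_minus by blast
  moreover have "a \<notin> Q" using x(3) * sQ submodule_add by blast
  ultimately show ?thesis using that * by simp
qed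

text \<open>Everything rests on two facts. First, \<open>W i\<close> meets \<open>Q i\<close> only
  in zero, so \<open>W i\<close> embeds in M modulo \<open>Q i\<close> and inherits uniformity.
  Second, every other \<open>W j\<close> lies in \<open>Q i\<close>, so reduction modulo
  \<open>Q i\<close> keeps only the i-th component of a sum, which gives directness.\<close>

lemma
  fixes Q :: "'i \<Rightarrow> _ set"
  assumes I: "finite I" and Q: "\<And>i. i \<in> I \<Longrightarrow> meet_irreducible R M (Q i)"
    and int: "carrier M \<inter> (\<Inter>i\<in>I. Q i) = {\<zero>\<^bsub>M\<^esub>}"
    and irr: "\<And>i. i \<in> I \<Longrightarrow> carrier M \<inter> (\<Inter>j\<in>I - {i}. Q j) \<noteq> {\<zero>\<^bsub>M\<^esub>}"
  defines "W \<equiv> \<lambda>i. carrier M \<inter> (\<Inter>j\<in>I - {i}. Q j)"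
  shows uniform_irredundant_components: "\<And>i. i \<in> I \<Longrightarrow> uniform_submodule R M (W i)"
    and direct_irredundant_components: "direct_family M I W"
    and essential_irredundant_components: "essential_submodule R M (submodule_sum M I W)"
proof -
  have sQ: "submodule (Q i) R M" if "i \<in> I" for i using Q[OF that] by (simp add: meet_irreducible_def)
  have sW: "submodule (W i) R M" for i unfolding W_def by (rule submodule_INT) (use sQ in auto)
  have WQ: "W i \<inter> Q i = {\<zero>\<^bsub>M\<^esub>}" if "i \<in> I" for i
    using int that unfolding W_def by blast
  have WQ': "W j \<subseteq> Q i" if "i \<in> I" "j \<noteq> i" for i j using that unfolding W_def by blast
  have notin: "\<not> A \<subseteq> Q i" if "i \<in> I" "submodule A R M" "A \<subseteq> W i" "A \<noteq> {\<zero>\<^bsub>M\<^esub>}" for A i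
    using WQ that submodule_zero by blast
  have rest: "finsum M x (I - {i}) \<in> Q i" if "x \<in> Pi I W" "i \<in> I" for x i
    by (rule submodule_finsum) (use that I sQ WQ' in fastforce)+
  have split: "finsum M x I = x i \<oplus>\<^bsub>M\<^esub> finsum M x (I - {i})" if "x \<in> Pi I W" "i \<in> I" for x i
  proof -
    have "x j \<in> carrier M" if "j \<in> I" for j using \<open>x \<in> Pi I W\<close> that unfolding W_def by blast
    then have "finsum M x (insert i (I - {i})) = x i \<oplus>\<^bsub>M\<^esub> finsum M x (I - {i})"
      using I \<open>i \<in> I\<close> by (intro M.finsum_insert) auto
    then show ?thesis using \<open>i \<in> I\<close> by (simp add: insert_absorb)
  qed
  show "uniform_submodule R M (W i)" if i: "i \<in> I" for i
    unfolding uniform_submodule_iff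
  proof (intro conjI allI impI; (elim conjE)?)
    fix A B assume A: "submodule A R M" "A \<subseteq> W i" "A \<noteq> {\<zero>\<^bsub>M\<^esub>}"
      and B: "submodule B R M" "B \<subseteq> W i" "B \<noteq> {\<zero>\<^bsub>M\<^esub>}"
    obtain a b where ab: "a \<in> A" "b \<in> B" "a \<notin> Q i" "a \<ominus>\<^bsub>M\<^esub> b \<in> Q i"
      using meet_irreducibleE[OF Q[OF i] A(1) notin[OF i A] B(1) notin[OF i B]] by blast
    have "a \<ominus>\<^bsub>M\<^esub> b \<in> W i" using ab A B sW submodule_minus by blast
    then have "a \<ominus>\<^bsub>M\<^esub> b = \<zero>\<^bsub>M\<^esub>" using WQ[OF i] ab by blast
    moreover have "a \<in> carrier M" "b \<in> carrier M" using ab A B submodule_subset by blast+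
    ultimately have "a = b" by (rule minus_eq_zeroD)
    moreover have "a \<noteq> \<zero>\<^bsub>M\<^esub>" using ab(3) submodule_zero[OF sQ[OF i]] by blast
    ultimately show "A \<inter> B \<noteq> {\<zero>\<^bsub>M\<^esub>}" using ab by blast
  qed (use sW irr[OF i] in \<open>auto simp: W_def\<close>)
  have sW': "\<forall>i\<in>I. submodule (W i) R M" using sW by blast
  show "direct_family M I W"
    unfolding direct_family_iff[OF I sW']
  proof (intro ballI impI)
    fix x i assume x: "x \<in> Pi I W" "finsum M x I = \<zero>\<^bsub>M\<^esub>" and i: "i \<in> I"
    have xi: "x i \<in> W i" using x i by blast
    have c: "x i \<in> carrier M" "finsum M x (I - {i}) \<in> carrier M"
      using xi rest[OF x(1) i] submodule_subset[OF sW] submodule_subset[OF sQ[OF i]] by blast+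
    have "x i = \<ominus>\<^bsub>M\<^esub> finsum M x (I - {i})"
      using split[OF x(1) i] x(2) c M.minus_equality[of "x i" "finsum M x (I - {i})"] by simp
    then have "x i \<in> Q i" using rest[OF x(1) i] submodule_uminus[OF sQ[OF i]] by simp
    then show "x i = \<zero>\<^bsub>M\<^esub>" using xi WQ[OF i] by blast
  qed
  \<comment> \<open>A submodule K inside \<open>Q i\<close> already lies in the sum. Otherwise K and
    \<open>W i\<close> both stick out of \<open>Q i\<close>, and meet irreducibility yields an
    element of K that is congruent to an element of \<open>W i\<close> modulo \<open>Q i\<close> and
    lies outside \<open>Q i\<close>.\<close>
  have "essential_submodule R M (W i <+>\<^bsub>M\<^esub> Q i)" if i: "i \<in> I" for i
    unfolding essential_submodule_def
  proof (intro conjI allI impI)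
    note E = submodule_set_add[OF sW[of i] sQ[OF i]]
    show "submodule (W i <+>\<^bsub>M\<^esub> Q i) R M" by (rule E(1))
    fix K assume K: "submodule K R M \<and> K \<noteq> {\<zero>\<^bsub>M\<^esub>}"
    show "(W i <+>\<^bsub>M\<^esub> Q i) \<inter> K \<noteq> {\<zero>\<^bsub>M\<^esub>}"
    proof (cases "K \<subseteq> Q i")
      case True
      then have "(W i <+>\<^bsub>M\<^esub> Q i) \<inter> K = K" using E(3) by blast
      then show ?thesis using K by simp
    next
      case False
      have "W i \<noteq> {\<zero>\<^bsub>M\<^esub>}" using irr[OF i] by (simp add: W_def)
      then obtain a b where ab: "a \<in> K" "b \<in> W i" "a \<notin> Q i" "a \<ominus>\<^bsub>M\<^esub> b \<in> Q i"
        using meet_irreducibleE[OF Q[OF i] _ False sW notin[OF i sW order_refl]] K by blast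
      have "a \<in> carrier M" "b \<in> carrier M" using ab K sW submodule_subset by blast+
      then have "a = b \<oplus>\<^bsub>M\<^esub> (a \<ominus>\<^bsub>M\<^esub> b)" by (simp add: M.minus_eq M.a_ac M.r_neg)
      then have "a \<in> W i <+>\<^bsub>M\<^esub> Q i" using ab unfolding set_add_def' by blast
      moreover have "a \<noteq> \<zero>\<^bsub>M\<^esub>" using ab(3) submodule_zero[OF sQ[OF i]] by blast
      ultimately show ?thesis using ab by blast
    qed
  qed
  then have ess: "essential_submodule R M (carrier M \<inter> (\<Inter>i\<in>I. W i <+>\<^bsub>M\<^esub> Q i))"
    by (rule essential_submodule_INT[OF I])
  show "essential_submodule R M (submodule_sum M I W)"
  proof (rule essential_submodule_mono[OF ess])
    show "submodule (submodule_sum M I W) R M" by (rule submodule_submodule_sum[OF I sW])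
    show "carrier M \<inter> (\<Inter>i\<in>I. W i <+>\<^bsub>M\<^esub> Q i) \<subseteq> submodule_sum M I W"
    proof
      fix x assume x: "x \<in> carrier M \<inter> (\<Inter>i\<in>I. W i <+>\<^bsub>M\<^esub> Q i)"
      then have "\<forall>i\<in>I. \<exists>w. w \<in> W i \<and> (\<exists>q\<in>Q i. x = w \<oplus>\<^bsub>M\<^esub> q)" unfolding set_add_def' by blast
      from bchoice[OF this] obtain w where w: "\<And>i. i \<in> I \<Longrightarrow> w i \<in> W i \<and> (\<exists>q\<in>Q i. x = w i \<oplus>\<^bsub>M\<^esub> q)"
        by blast
      have wP: "w \<in> Pi I W" using w by blast
      have wc: "finsum M w I \<in> carrier M" using w submodule_subset[OF sW] by (intro M.finsum_closed) blast
      \<comment> \<open>The components \<open>w i\<close> were chosen independently of one another.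
        Modulo \<open>Q i\<close>, both x and the sum of all \<open>w j\<close> reduce to
        \<open>w i\<close>, so their difference y lies in every \<open>Q i\<close> and is therefore
        zero.\<close>
      define y where "y = x \<ominus>\<^bsub>M\<^esub> finsum M w I"
      have "y \<in> Q i" if i: "i \<in> I" for i
      proof -
        define s where "s = finsum M w (I - {i})"
        obtain q where q: "q \<in> Q i" "x = w i \<oplus>\<^bsub>M\<^esub> q" using w[OF i] by blast
        have s: "s \<in> Q i" unfolding s_def by (rule rest[OF wP i])
        have c: "q \<in> carrier M" "s \<in> carrier M" "w i \<in> carrier M"
          using q s w[OF i] submodule_subset[OF sQ[OF i]] submodule_subset[OF sW] by blast+
        have "y = (w i \<oplus>\<^bsub>M\<^esub> q) \<ominus>\<^bsub>M\<^esub> (w i \<oplus>\<^bsub>M\<^esub> s)"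
          using split[OF wP i] q(2) by (simp add: y_def s_def)
        also have "\<dots> = q \<ominus>\<^bsub>M\<^esub> s" using c
          by (simp add: M.minus_eq M.minus_add M.a_assoc M.a_lcomm[of "w i" q] M.r_neg2)
        finally show ?thesis using q(1) s submodule_minus[OF sQ[OF i]] by simp
      qed
      then have "y = \<zero>\<^bsub>M\<^esub>" using int x wc unfolding y_def by blast
      then have "x = finsum M w I" using x wc unfolding y_def by (blast intro: minus_eq_zeroD)
      then show "x \<in> submodule_sum M I W" using wP I unfolding submodule_sum_def by blast
    qed
  qed
qed

text \<open>Among the subfamilies with zero intersection, one of least cardinality is irredundant.
  Its components \<open>W i\<close> then compute the uniform dimension exactly as its
  cardinality.\<close>

lemma udim_le_card:
  fixes Q :: "'i \<Rightarrow> _ set"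
  assumes J: "finite J" and Q: "\<And>i. i \<in> J \<Longrightarrow> meet_irreducible R M (Q i)"
    and int: "carrier M \<inter> (\<Inter>i\<in>J. Q i) = {\<zero>\<^bsub>M\<^esub>}"
  shows "udim R M \<le> card J"
proof -
  let ?P = "\<lambda>I. I \<subseteq> J \<and> carrier M \<inter> (\<Inter>i\<in>I. Q i) = {\<zero>\<^bsub>M\<^esub>}"
  obtain I where I: "?P I" and min: "\<And>I'. ?P I' \<Longrightarrow> card I \<le> card I'"
    using ex_has_least_nat[of ?P J card] int by blast
  have fI: "finite I" using I J finite_subset by blast
  \<comment> \<open>The subfamily is renumbered by an initial segment of the naturals because
    \<open>udim\<close> refers to families indexed that way.\<close>
  obtain h where h: "bij_betw h {..<card I} I"
    using ex_bij_betw_nat_finite[OF fI] by (auto simp: lessThan_atLeast0)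
  have hI: "h ` {..<card I} = I" using h by (rule bij_betw_imp_surj_on)
  have int': "carrier M \<inter> (\<Inter>k<card I. Q (h k)) = {\<zero>\<^bsub>M\<^esub>}"
  proof -
    have "(\<Inter>k<card I. Q (h k)) = (\<Inter>i\<in>h ` {..<card I}. Q i)" by blast
    then show ?thesis using I hI by simp
  qed
  have Q': "meet_irreducible R M (Q (h k))" if "k \<in> {..<card I}" for k
    using that hI I Q by blast
  \<comment> \<open>Since h is injective, omitting the index k omits exactly the member
    \<open>h k\<close> of I; the intersection becoming zero again would contradict minimality of
    \<open>card I\<close>.\<close>
  have irr: "carrier M \<inter> (\<Inter>j\<in>{..<card I} - {k}. Q (h j)) \<noteq> {\<zero>\<^bsub>M\<^esub>}" if k: "k \<in> {..<card I}" for k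
  proof
    assume z: "carrier M \<inter> (\<Inter>j\<in>{..<card I} - {k}. Q (h j)) = {\<zero>\<^bsub>M\<^esub>}"
    have "h k \<in> I" using k hI by blast
    have "h ` ({..<card I} - {k}) = I - {h k}"
      using h k by (simp add: bij_betw_def inj_on_image_set_diff[of h "{..<card I}"])
    then have "carrier M \<inter> (\<Inter>i\<in>I - {h k}. Q i) = {\<zero>\<^bsub>M\<^esub>}" using z
      by (metis image_image)
    then have "card I \<le> card (I - {h k})" using I by (intro min) blast
    then show False using \<open>h k \<in> I\<close> fI by (metis card_Diff1_less not_less)
  qed
  have "udim R M = card I"
    using uniform_irredundant_components[OF finite_lessThan Q' int' irr]
      direct_irredundant_components[OF finite_lessThan Q' int' irr]
      essential_irredundant_components[OF finite_lessThan Q' int' irr]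
    by (intro udim_eqI) auto
  then show ?thesis using I J card_mono by metis
qed

subsection \<open>Essential equivalence\<close>

text \<open>An isomorphism f from L1 in U onto an essential L2 in V is restricted to
  \<open>L1 \<inter> U'\<close>, which is nonzero because M is uniform. The image stays essential in
  V. Keeping V arbitrary gives equality of classes directly, without proving transitivity of
  \<open>ess_equiv\<close>.\<close>

lemma ess_equiv_uniform_submodules:
  assumes M: "uniform_module R M" and U: "uniform_submodule R M U" "uniform_submodule R M U'"
    and V: "left_module R V" and eq: "ess_equiv R (restrict_to M U) V"
  shows "ess_equiv R (restrict_to M U') V"
proof -
  interpret V: left_module R V by (rule V)
  have sU: "submodule U R M" "submodule U' R M" using U by (simp_all add: uniform_submodule_iff)
  obtain L1 L2 f where L1: "essential_submodule R (restrict_to M U) L1"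
    and L2: "essential_submodule R V L2"
    and bij: "bij_betw f L1 L2"
    and f_add: "\<And>x y. x \<in> L1 \<Longrightarrow> y \<in> L1 \<Longrightarrow> f (x \<oplus>\<^bsub>M\<^esub> y) = f x \<oplus>\<^bsub>V\<^esub> f y"
    and f_smult: "\<And>r x. r \<in> carrier R \<Longrightarrow> x \<in> L1 \<Longrightarrow> f (r \<odot>\<^bsub>M\<^esub> x) = r \<odot>\<^bsub>V\<^esub> f x"
    using eq unfolding ess_equiv_def modules_isomorphic_def by auto
  have sL1: "submodule L1 R M" "L1 \<subseteq> U" and sL2: "submodule L2 R V"
    using L1 L2 submodule_restrict_iff[OF sU(1)] unfolding essential_submodule_def by auto
  have f_mem: "f x \<in> L2" if "x \<in> L1" for x using bij that by (auto simp: bij_betw_def)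
  \<comment> \<open>Preservation of zero is not part of \<open>modules_isomorphic\<close>; it
    follows from compatibility with multiplication by the zero scalar.\<close>
  have f_zero: "f \<zero>\<^bsub>M\<^esub> = \<zero>\<^bsub>V\<^esub>"
    using f_smult[of "\<zero>\<^bsub>R\<^esub>" "\<zero>\<^bsub>M\<^esub>"] f_mem[of "\<zero>\<^bsub>M\<^esub>"] submodule_zero[OF sL1(1)] V.submodule_subset[OF sL2] by auto
  have f_nz: "f x \<noteq> \<zero>\<^bsub>V\<^esub>" if "x \<in> L1" "x \<noteq> \<zero>\<^bsub>M\<^esub>" for x
    using that bij f_zero submodule_zero[OF sL1(1)] by (metis bij_betw_def inj_onD)
  \<comment> \<open>Essentiality of L1 in U is tested on U itself, which shows that L1 is
    nonzero.\<close>
  have "L1 \<inter> U \<noteq> {\<zero>\<^bsub>M\<^esub>}"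
    using L1 U(1) sU submodule_restrict_iff[OF sU(1)]
    unfolding essential_submodule_def uniform_submodule_iff by auto
  then have "L1 \<noteq> {\<zero>\<^bsub>M\<^esub>}" using sL1(2) by (metis inf.absorb1)
  define L where "L = L1 \<inter> U'"
  have sL: "submodule L R M" unfolding L_def using sL1 sU submodule_Int by blast
  have L_nz: "L \<noteq> {\<zero>\<^bsub>M\<^esub>}" unfolding L_def
    using M U sL1 sU \<open>L1 \<noteq> {\<zero>\<^bsub>M\<^esub>}\<close> unfolding uniform_module_iff uniform_submodule_iff by blast
  have "uniform_module R (restrict_to M U')" using U by (simp add: uniform_submodule_def)
  then have "essential_submodule R (restrict_to M U') L"
    using sL L_nz submodule_restrict_iff[OF sU(2)] unfolding uniform_module_def L_def by auto
  moreover have "essential_submodule R V (f ` L)"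
    unfolding essential_submodule_def
  proof (intro conjI allI impI)
    show "submodule (f ` L) R V"
      unfolding V.submodule_iff
    proof (intro conjI ballI)
      show "f ` L \<subseteq> carrier V" using f_mem V.submodule_subset[OF sL2] unfolding L_def by blast
      show "\<zero>\<^bsub>V\<^esub> \<in> f ` L" using f_zero submodule_zero[OF sL] by (metis imageI)
    next
      fix x y assume "x \<in> f ` L" "y \<in> f ` L"
      then obtain a b where ab: "a \<in> L" "b \<in> L" "x = f a" "y = f b" by blast
      then have "x \<oplus>\<^bsub>V\<^esub> y = f (a \<oplus>\<^bsub>M\<^esub> b)" using f_add by (simp add: L_def)
      then show "x \<oplus>\<^bsub>V\<^esub> y \<in> f ` L" using submodule_add[OF sL ab(1,2)] by simp
    next
      fix r x assume r: "r \<in> carrier R" and "x \<in> f ` L"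
      then obtain a where a: "a \<in> L" "x = f a" by blast
      then have "r \<odot>\<^bsub>V\<^esub> x = f (r \<odot>\<^bsub>M\<^esub> a)" using f_smult r by (simp add: L_def)
      then show "r \<odot>\<^bsub>V\<^esub> x \<in> f ` L" using submodule_smult[OF sL r a(1)] by simp
    qed
  next
    fix K assume K: "submodule K R V \<and> K \<noteq> {\<zero>\<^bsub>V\<^esub>}"
    define K' where "K' = {x \<in> L1. f x \<in> K}"
    have "L2 \<inter> K \<noteq> {\<zero>\<^bsub>V\<^esub>}" using L2 K unfolding essential_submodule_def by blast
    moreover have "submodule (L2 \<inter> K) R V" using sL2 K V.submodule_Int by blast
    ultimately obtain k where k: "k \<in> L2" "k \<in> K" "k \<noteq> \<zero>\<^bsub>V\<^esub>" using V.submodule_nonzeroE by blast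
    then obtain x where "x \<in> L1" "f x = k" using bij by (auto simp: bij_betw_def)
    then have "x \<in> K'" "x \<noteq> \<zero>\<^bsub>M\<^esub>" using k f_zero by (auto simp: K'_def)
    then have "K' \<noteq> {\<zero>\<^bsub>M\<^esub>}" by blast
    moreover have sK': "submodule K' R M"
      using sL1(1) K f_zero unfolding submodule_iff V.submodule_iff K'_def
      by (auto simp: f_add f_smult)
    ultimately have "L \<inter> K' \<noteq> {\<zero>\<^bsub>M\<^esub>}" using M sL L_nz unfolding uniform_module_iff by blast
    then obtain y where "y \<in> L" "y \<in> K'" "y \<noteq> \<zero>\<^bsub>M\<^esub>"
      using submodule_nonzeroE[OF submodule_Int[OF sL sK']] by blast
    then show "f ` L \<inter> K \<noteq> {\<zero>\<^bsub>V\<^esub>}" using f_nz unfolding K'_def by blast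
  qed
  moreover have "bij_betw f L (f ` L)" using bij unfolding L_def
    by (auto simp: bij_betw_def intro: inj_on_subset)
  then have "modules_isomorphic R (restrict_to (restrict_to M U') L) (restrict_to V (f ` L))"
    unfolding modules_isomorphic_def using f_add f_smult by (auto simp: L_def intro!: exI[of _ f])
  ultimately show ?thesis unfolding ess_equiv_def by blast
qed

text \<open>The whole module is itself a uniform submodule, so \<open>As\<close> is nonempty, and it
  serves as the reference to which every other uniform submodule is compared.\<close>

lemma As_uniform_module:
  assumes "uniform_module R M" shows "is_singleton (As R M)"
proof -
  have c: "uniform_submodule R M (carrier M)"
    using assms submodule_carrier unfolding uniform_submodule_iff uniform_module_iff by blast
  have "ess_class R (restrict_to M U) = ess_class R (restrict_to M (carrier M))"
    if "uniform_submodule R M U" for U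
    using ess_equiv_uniform_submodules[OF assms that c] ess_equiv_uniform_submodules[OF assms c that]
    unfolding ess_class_def by blast
  then have "As R M = {ess_class R (restrict_to M (carrier M))}" using c unfolding As_def by auto
  then show ?thesis by (simp add: is_singleton_def)
qed

end

subsection \<open>Factor modules\<close>

text \<open>The codomain V is not assumed to be a module: the module laws are transported along the
  surjection f. For a factor module it is then enough to check that the coset map is compatible with
  the operations.\<close>

locale module_epimorphism = left_module R M
  for R :: "('r, 'q) ring_scheme" and M :: "('r, 'm, 'x) module_scheme" +
  fixes V :: "('r, 'n, 'y) module_scheme" and f
  assumes carrier_eq: "carrier V = f ` carrier M"
    and f_zero: "f \<zero>\<^bsub>M\<^esub> = \<zero>\<^bsub>V\<^esub>"
    and f_add: "\<lbrakk>x \<in> carrier M; y \<in> carrier M\<rbrakk> \<Longrightarrow> f (x \<oplus>\<^bsub>M\<^esub> y) = f x \<oplus>\<^bsub>V\<^esub> f y"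
    and f_smult: "\<lbrakk>r \<in> carrier R; x \<in> carrier M\<rbrakk> \<Longrightarrow> f (r \<odot>\<^bsub>M\<^esub> x) = r \<odot>\<^bsub>V\<^esub> f x"
begin

lemma left_module_codomain: "left_module R V"
proof -
  have "abelian_group V"
  proof (rule abelian_groupI)
    fix x assume "x \<in> carrier V"
    then obtain a where a: "a \<in> carrier M" "x = f a" by (auto simp: carrier_eq)
    then have "f (\<ominus>\<^bsub>M\<^esub> a) \<oplus>\<^bsub>V\<^esub> x = \<zero>\<^bsub>V\<^esub>" by (simp add: M.l_neg f_zero flip: f_add)
    then show "\<exists>y\<in>carrier V. y \<oplus>\<^bsub>V\<^esub> x = \<zero>\<^bsub>V\<^esub>" using a by (auto simp: carrier_eq)
  qed (auto simp: carrier_eq M.a_ac simp flip: f_add f_zero)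
  moreover have "left_module_axioms R V"
    by unfold_locales
      (auto simp: carrier_eq smult_l_distr smult_r_distr smult_assoc1 simp flip: f_add f_smult)
  ultimately show ?thesis using R.ring_axioms by (simp add: left_module_def)
qed

sublocale V: left_module R V by (rule left_module_codomain)

lemma submodule_vimage:
  assumes "submodule B R V" shows "submodule {x \<in> carrier M. f x \<in> B} R M"
  using assms unfolding submodule_iff V.submodule_iff by (auto simp: f_zero f_add f_smult)

lemma submodule_image:
  assumes "submodule A R M" shows "submodule (f ` A) R V"
  unfolding V.submodule_iff
proof (intro conjI ballI)
  note s = submodule_subset[OF assms, THEN subsetD]
  show "f ` A \<subseteq> carrier V" using s by (auto simp: carrier_eq)
  show "\<zero>\<^bsub>V\<^esub> \<in> f ` A" using f_zero submodule_zero[OF assms] by (metis imageI)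
  fix x assume "x \<in> f ` A"
  then obtain a where a: "a \<in> A" "x = f a" by blast
  show "x \<oplus>\<^bsub>V\<^esub> y \<in> f ` A" if "y \<in> f ` A" for y
    using that a submodule_add[OF assms] s by (auto simp flip: f_add)
  show "r \<odot>\<^bsub>V\<^esub> x \<in> f ` A" if "r \<in> carrier R" for r
    using that a submodule_smult[OF assms] s by (auto simp flip: f_smult)
qed

text \<open>Elements with equal images differ by an element of the kernel, and P absorbs the kernel.
  This is the part of the correspondence theorem that lets intersections be compared upstairs and
  downstairs.\<close>

lemma mem_image_iff:
  assumes P: "submodule P R M" and ker: "{x \<in> carrier M. f x = \<zero>\<^bsub>V\<^esub>} \<subseteq> P" and x: "x \<in> carrier M"
  shows "f x \<in> f ` P \<longleftrightarrow> x \<in> P"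
proof
  assume "f x \<in> f ` P"
  then obtain p where p: "p \<in> P" "f x = f p" by blast
  have pc: "p \<in> carrier M" using p submodule_subset[OF P] by blast
  have "f (x \<ominus>\<^bsub>M\<^esub> p) = f x \<oplus>\<^bsub>V\<^esub> f (\<ominus>\<^bsub>M\<^esub> p)" using x pc by (simp add: M.minus_eq f_add)
  also have "\<dots> = f (p \<ominus>\<^bsub>M\<^esub> p)" using p pc by (simp add: M.minus_eq f_add)
  also have "\<dots> = \<zero>\<^bsub>V\<^esub>" using pc by (simp add: M.minus_eq M.r_neg f_zero)
  finally have "x \<ominus>\<^bsub>M\<^esub> p \<in> P" using ker x pc by blast
  then have "p \<oplus>\<^bsub>M\<^esub> (x \<ominus>\<^bsub>M\<^esub> p) \<in> P" using p submodule_add[OF P] by blast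
  then show "x \<in> P" using x pc by (simp add: M.minus_eq M.a_lcomm[of p x] M.r_neg)
qed blast

text \<open>The preimages of A and B properly contain P, so they share an element outside P. Its
  image lies in A and B but not in the image of P, since P contains the kernel.\<close>

lemma meet_irreducible_image:
  assumes P: "meet_irreducible R M P" and ker: "{x \<in> carrier M. f x = \<zero>\<^bsub>V\<^esub>} \<subseteq> P"
  shows "meet_irreducible R V (f ` P)"
  unfolding meet_irreducible_def
proof (intro conjI allI impI; (elim conjE)?)
  have sP: "submodule P R M" using P by (simp add: meet_irreducible_def)
  note mem = mem_image_iff[OF sP ker]
  show "submodule (f ` P) R V" using sP by (rule submodule_image)
  show "f ` P \<noteq> carrier V"
    using P mem submodule_subset[OF sP] unfolding carrier_eq meet_irreducible_def by blast
  fix A B assume A: "submodule A R V" "f ` P \<subset> A" and B: "submodule B R V" "f ` P \<subset> B"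
  have sub: "P \<subset> {x \<in> carrier M. f x \<in> C}" if "submodule C R V" "f ` P \<subset> C" for C
    using that V.submodule_subset[OF that(1)] submodule_subset[OF sP] unfolding carrier_eq by blast
  have "{x \<in> carrier M. f x \<in> A} \<inter> {x \<in> carrier M. f x \<in> B} \<noteq> P"
    using P sub[OF A] sub[OF B] submodule_vimage[OF A(1)] submodule_vimage[OF B(1)]
    unfolding meet_irreducible_def by simp
  then obtain x where "x \<in> carrier M" "f x \<in> A" "f x \<in> B" "x \<notin> P" using sub[OF A] sub[OF B] by blast
  then show "A \<inter> B \<noteq> f ` P" using mem by blast
qed

text \<open>The images of A and B are nonzero, so by uniformity they share a nonzero v. A preimage
  of v taken in A also lies in B, because B contains the kernel, and it lies outside the kernel
  because v is nonzero.\<close>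

lemma meet_irreducible_kernel:
  assumes V: "uniform_module R V"
  shows "meet_irreducible R M {x \<in> carrier M. f x = \<zero>\<^bsub>V\<^esub>}" (is "meet_irreducible R M ?K")
  unfolding meet_irreducible_def
proof (intro conjI allI impI; (elim conjE)?)
  have "submodule {\<zero>\<^bsub>V\<^esub>} R V" by (simp add: V.submodule_iff)
  from submodule_vimage[OF this] show sK: "submodule ?K R M" by simp
  show "?K \<noteq> carrier M"
  proof
    assume "?K = carrier M"
    then have "carrier V = {\<zero>\<^bsub>V\<^esub>}" using submodule_zero[OF sK] by (force simp: carrier_eq)
    then show False using V by (simp add: uniform_module_def)
  qed
  fix A B assume A: "submodule A R M" "?K \<subset> A" and B: "submodule B R M" "?K \<subset> B"
  have nz: "f ` C \<noteq> {\<zero>\<^bsub>V\<^esub>}" if "submodule C R M" "?K \<subset> C" for C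
    using that submodule_subset[OF that(1)] by blast
  have ne: "f ` A \<inter> f ` B \<noteq> {\<zero>\<^bsub>V\<^esub>}"
    using V nz[OF A] nz[OF B] submodule_image[OF A(1)] submodule_image[OF B(1)]
    unfolding V.uniform_module_iff by simp
  have "submodule (f ` A \<inter> f ` B) R V"
    by (intro V.submodule_Int submodule_image A(1) B(1))
  then obtain v where v: "v \<in> f ` A" "v \<in> f ` B" "v \<noteq> \<zero>\<^bsub>V\<^esub>"
    by (rule V.submodule_nonzeroE[OF _ ne]) blast
  then obtain a where a: "a \<in> A" "v = f a" by blast
  have "a \<in> carrier M" using a(1) submodule_subset[OF A(1)] by blast
  then have "a \<in> B" using mem_image_iff[OF B(1) psubset_imp_subset[OF B(2)]] v(2) a(2) by simp
  moreover have "a \<notin> ?K" using a(2) v(3) by simp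
  ultimately show "A \<inter> B \<noteq> ?K" using a(1) by blast
qed

end

lemma (in left_module) factor_module_epimorphism:
  assumes N: "submodule N R M"
  shows "module_epimorphism R M (factor_module M N) (a_r_coset M N)"
    and "{x \<in> carrier M. N +>\<^bsub>M\<^esub> x = N} = N"
proof -
  have "additive_subgroup N M"
    using submodule.axioms(1)[OF N] by (rule additive_subgroup.intro)
  then interpret N: abelian_subgroup N M using M.abelian_group_axioms by (intro abelian_subgroupI3)
  note s = submodule_subset[OF N, THEN subsetD]
  show "{x \<in> carrier M. N +>\<^bsub>M\<^esub> x = N} = N"
    using s N.a_rcos_self M.a_coset_join2[OF _ N.a_subgroup] by auto
  show "module_epimorphism R M (factor_module M N) (a_r_coset M N)"
  proof unfold_locales
    show "carrier (factor_module M N) = a_r_coset M N ` carrier M"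
      by (auto simp: factor_module_def A_RCOSETS_def')
    show "N +>\<^bsub>M\<^esub> \<zero>\<^bsub>M\<^esub> = \<zero>\<^bsub>factor_module M N\<^esub>"
      using s by (simp add: factor_module_def subsetI)
    show "N +>\<^bsub>M\<^esub> (x \<oplus>\<^bsub>M\<^esub> y) = (N +>\<^bsub>M\<^esub> x) \<oplus>\<^bsub>factor_module M N\<^esub> (N +>\<^bsub>M\<^esub> y)"
      if "x \<in> carrier M" "y \<in> carrier M" for x y
      using that by (simp add: factor_module_def N.a_rcos_sum)
  next
    fix r x assume r: "r \<in> carrier R" and x: "x \<in> carrier M"
    \<comment> \<open>Scalar multiplication of cosets is defined as a union over all
      representatives. Every representative contributes the same coset, and there is at least one,
      so the union collapses to that coset.\<close>
    have "N +>\<^bsub>M\<^esub> (r \<odot>\<^bsub>M\<^esub> y) = N +>\<^bsub>M\<^esub> (r \<odot>\<^bsub>M\<^esub> x)" if y: "y \<in> N +>\<^bsub>M\<^esub> x" for y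
    proof -
      obtain n where n: "n \<in> N" "y = n \<oplus>\<^bsub>M\<^esub> x" using y unfolding a_r_coset_def' by blast
      then have "r \<odot>\<^bsub>M\<^esub> y = r \<odot>\<^bsub>M\<^esub> n \<oplus>\<^bsub>M\<^esub> r \<odot>\<^bsub>M\<^esub> x" using r x s by (simp add: smult_r_distr)
      then have "r \<odot>\<^bsub>M\<^esub> y \<in> N +>\<^bsub>M\<^esub> (r \<odot>\<^bsub>M\<^esub> x)"
        using submodule_smult[OF N r n(1)] by (auto simp: a_r_coset_def')
      then show ?thesis using N.a_repr_independence'[of "r \<odot>\<^bsub>M\<^esub> y" "r \<odot>\<^bsub>M\<^esub> x"] r x by simp
    qed
    moreover have "x \<in> N +>\<^bsub>M\<^esub> x" using x by (rule N.a_rcos_self)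
    ultimately have "(\<Union>y\<in>N +>\<^bsub>M\<^esub> x. N +>\<^bsub>M\<^esub> (r \<odot>\<^bsub>M\<^esub> y)) = N +>\<^bsub>M\<^esub> (r \<odot>\<^bsub>M\<^esub> x)"
      by blast
    then show "N +>\<^bsub>M\<^esub> (r \<odot>\<^bsub>M\<^esub> x) = r \<odot>\<^bsub>factor_module M N\<^esub> (N +>\<^bsub>M\<^esub> x)"
      by (simp add: factor_module_def)
  qed
qed

section \<open>Primary components and irredundance of shortest uniform decompositions\<close>

theorem corollary6p2:
  fixes R :: "('r, 'q) ring_scheme"
    and M :: "('r, 'm, 'x) module_scheme"
    and N :: "'m set"
    and s :: nat
    and P :: "nat \<Rightarrow> 'm set"
  assumes "left_module R M"
    and "carrier M \<noteq> {\<zero>\<^bsub>M\<^esub>}"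
    and "uniformly_finite R M"
    and "submodule N R M"
    and "N \<noteq> carrier M"
    and "shortest_uniform_decomposition R M N s P"
  shows "primary_decomposition R M N s P \<and> irredundant M N s P"
proof
  interpret left_module R M by fact
  have s: "s \<ge> 1" "N = (\<Inter>i\<in>{1..s}. P i)" "s = udim R (factor_module M N)"
    and P: "\<And>i. i \<in> {1..s} \<Longrightarrow> submodule (P i) R M"
      "\<And>i. i \<in> {1..s} \<Longrightarrow> uniform_module R (factor_module M (P i))"
    using assms(6)[unfolded shortest_uniform_decomposition_def uniform_decomposition_def]
    by (elim conjE; (assumption | blast))+
  have "primary_submodule R M (P i)" if i: "i \<in> {1..s}" for i
  proof -
    interpret F: module_epimorphism R M "factor_module M (P i)" "a_r_coset M (P i)"
      by (rule factor_module_epimorphism(1)[OF P(1)[OF i]])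
    show ?thesis using P[OF i] assms(3) F.V.As_uniform_module
      unfolding primary_submodule_def uniformly_finite_def by blast
  qed
  then show "primary_decomposition R M N s P"
    using s unfolding primary_decomposition_def by blast
  interpret F: module_epimorphism R M "factor_module M N" "a_r_coset M N"
    by (rule factor_module_epimorphism(1)[OF assms(4)])
  have zero: "\<zero>\<^bsub>factor_module M N\<^esub> = N" by (simp add: factor_module_def)
  have ker: "{x \<in> carrier M. N +>\<^bsub>M\<^esub> x = \<zero>\<^bsub>factor_module M N\<^esub>} = N"
    unfolding zero by (rule factor_module_epimorphism(2)[OF assms(4)])
  have mi: "meet_irreducible R M (P i)" if i: "i \<in> {1..s}" for i
  proof -
    interpret G: module_epimorphism R M "factor_module M (P i)" "a_r_coset M (P i)"
      by (rule factor_module_epimorphism(1)[OF P(1)[OF i]])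
    show ?thesis
      using G.meet_irreducible_kernel[OF P(2)[OF i]] factor_module_epimorphism(2)[OF P(1)[OF i]]
      by (simp add: factor_module_def)
  qed
  show "irredundant M N s P"
    unfolding irredundant_def
  proof (intro ballI notI)
    \<comment> \<open>If \<open>P j\<close> could be dropped, the images of the remaining s - 1
      submodules in M/N would be meet irreducible with zero intersection, which bounds the uniform
      dimension by s - 1.\<close>
    fix j assume j: "j \<in> {1..s}" and red: "carrier M \<inter> (\<Inter>i\<in>{1..s} - {j}. P i) = N"
    define Q where "Q = (\<lambda>i. a_r_coset M N ` P i)"
    have NP: "N \<subseteq> P i" if "i \<in> {1..s}" for i using that s(2) by blast
    have "meet_irreducible R (factor_module M N) (Q i)" if "i \<in> {1..s} - {j}" for i
      unfolding Q_def by (rule F.meet_irreducible_image) (use mi NP that ker in auto)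
    \<comment> \<open>Taking images commutes with this intersection because every \<open>P i\<close>
      contains N, the kernel of the coset map. For s = 1 the index set is empty and the carrier
      stands for the empty intersection.\<close>
    moreover have "carrier (factor_module M N) \<inter> (\<Inter>i\<in>{1..s} - {j}. Q i) = {\<zero>\<^bsub>factor_module M N\<^esub>}"
    proof (intro equalityI subsetI)
      fix v assume v: "v \<in> carrier (factor_module M N) \<inter> (\<Inter>i\<in>{1..s} - {j}. Q i)"
      then obtain x where x: "x \<in> carrier M" "v = N +>\<^bsub>M\<^esub> x" by (auto simp: F.carrier_eq)
      have "x \<in> P i" if "i \<in> {1..s} - {j}" for i
        using that v x F.mem_image_iff[OF P(1)[of i], of x] ker NP[of i] unfolding Q_def by blast
      then have "x \<in> N" using red x by blast
      then show "v \<in> {\<zero>\<^bsub>factor_module M N\<^esub>}" using x ker by blast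
    next
      fix v assume v: "v \<in> {\<zero>\<^bsub>factor_module M N\<^esub>}"
      have "\<zero>\<^bsub>factor_module M N\<^esub> \<in> Q i" if "i \<in> {1..s} - {j}" for i
        unfolding Q_def using F.V.submodule_zero[OF F.submodule_image] P(1) that by blast
      then show "v \<in> carrier (factor_module M N) \<inter> (\<Inter>i\<in>{1..s} - {j}. Q i)" using v by auto
    qed
    ultimately have "udim R (factor_module M N) \<le> card ({1..s} - {j})"
      by (intro F.V.udim_le_card) auto
    also have "\<dots> < s" using j s(1) by simp
    finally show False using s(3) by simp
  qed
qed

end
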